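(* Let $\mathcal{F}\subset\mathrm{Hom}(\mathbb{S}^1)$ and $\mathcal{F}^-=\{f^{-1}: f\in\mathcal{F}\}$. Assume that there is no finite nonempty set that is invariant under all maps in $\mathcal{F}$ simultaneously. Let $d_+$ and $d_-$ be the numbers of $\mathcal{F}$-minimal sets and of $\mathcal{F}^-$-minimal sets respectively. Then $$|d_+-d_-|\leq1.$$ Moreover, if $\mathcal{F}\subset\mathrm{Hom}^+(\mathbb{S}^1)$, then $d_+=d_-$.
   Context: $\mathrm{Hom}(\mathbb{S}^1)$ is the group of homeomorphisms of the circle and $\mathrm{Hom}^+(\mathbb{S}^1)$ the subgroup of orientation-preserving ones. For a family $\mathcal{G}\subset\mathrm{Hom}(\mathbb{S}^1)$, a nonempty set $K\subset\mathbb{S}^1$ is $\mathcal{G}$-invariant if $f(K)\subset K$ for all $f\in\mathcal{G}$; a nonempty closed set $K$ is $\mathcal{G}$-minimal if it is $\mathcal{G}$-invariant and no nonempty closed proper subset of $K$ is $\mathcal{G}$-invariant. It is known (Malicet 2017) that in the absence of finite invariant sets the number of minimal sets is finite. *)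

theory Defs
  imports "HOL-Analysis.Analysis"
begin

abbreviation circle :: "complex set" where
  "circle \<equiv> sphere 0 1"

text \<open>Circle maps are total functions on the complex plane; only their values on the
  circle matter.\<close>

definition circle_homeos :: "(complex \<Rightarrow> complex) set" where
  "circle_homeos = {f. \<exists>g. homeomorphism circle circle f g}"

text \<open>A circle homeomorphism preserves orientation if it has a strictly increasing lift
  along the universal covering \<^term>\<open>cis\<close>. The relation
  \<^term>\<open>F (t + 2 * pi) = F t + 2 * pi\<close> is then automatic by injectivity.\<close>

definition circle_homeos_pos :: "(complex \<Rightarrow> complex) set" where
  "circle_homeos_pos = {f \<in> circle_homeos.
     \<exists>F :: real \<Rightarrow> real. continuous_on UNIV F \<and> strict_mono F \<and> (\<forall>t. f (cis t) = cis (F t))}"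

definition inverse_family :: "(complex \<Rightarrow> complex) set \<Rightarrow> (complex \<Rightarrow> complex) set" where
  "inverse_family \<F> = inv_into circle ` \<F>"

definition invariant_set :: "(complex \<Rightarrow> complex) set \<Rightarrow> complex set \<Rightarrow> bool" where
  "invariant_set \<G> K \<longleftrightarrow> K \<noteq> {} \<and> K \<subseteq> circle \<and> (\<forall>f\<in>\<G>. f ` K \<subseteq> K)"

definition minimal_set :: "(complex \<Rightarrow> complex) set \<Rightarrow> complex set \<Rightarrow> bool" where
  "minimal_set \<G> K \<longleftrightarrow> closed K \<and> invariant_set \<G> K \<and>
     \<not> (\<exists>L. L \<noteq> {} \<and> closed L \<and> L \<subset> K \<and> invariant_set \<G> L)"

end

theory Submission
  imports Defs
begin

text \<open>Colour the points of finitely many minimal sets of \<open>\<F>\<close> and look at the arcs (gaps) that join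
  two colours. There are finitely many, and each \<open>f \<in> \<F>\<close> maps every gap over at least one gap, hence
  over exactly one of the same colours. So the closed gaps of a given colour pair form an invariant
  set of the inverse family, and \<open>d\<^sub>-\<close> is at least the number of colour pairs that occur. The graph of
  these pairs is connected, which gives \<open>d\<^sub>+ - 1 \<le> d\<^sub>-\<close>; if orientation is preserved, ordered pairs
  count and \<open>d\<^sub>+ \<le> d\<^sub>-\<close>. For finiteness, three minimal sets of an orientation-preserving family
  follow each other cyclically; infinitely many of them would therefore shrink to a finite invariant
  set. The general case follows by passing to the orientation-preserving words.\<close>

section \<open>Lifts of circle homeomorphisms\<close>

text \<open>The obstacle is that a map of the family may send a minimal set onto a proper part of
  itself, so it need not carry gaps to gaps, and a preimage of a coloured point may be colourless.
  Only covering survives, and counting the gaps turns it into a statement about preimages. The 1 in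
  the bound comes from reversal of orientation: it exchanges the two ends of a gap, so only
  unordered colour pairs persist, and a connected graph on \<open>n\<close> vertices may have as few
  as \<open>n - 1\<close> edges. Finite invariant sets must be excluded for two reasons: closed gaps
  of different types can share end points, and a sequence of minimal sets can collapse to finitely
  many points. A finite set invariant under the inverse family is invariant under \<F> as well, so
  the hypothesis passes to the inverse family and one argument gives both inequalities.\<close>

lemma cis_eq_cis_iff: "cis a = cis b \<longleftrightarrow> (\<exists>n::int. a = b + 2 * pi * n)"
  using sin_cos_eq_iff[of a b] by (auto simp: complex_eq_iff)

lemma cis_shift [simp]: "cis (t + 2 * pi * of_int n) = cis t"
  by (metis cis_eq_cis_iff)

lemma cis_shift' [simp]: "cis (t + 2 * pi) = cis t" "cis (t - 2 * pi) = cis t"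
  using cis_shift[of t 1] cis_shift[of t "-1"] by simp_all

lemma circle_cis: "z \<in> circle \<Longrightarrow> \<exists>t. z = cis t"
  using cis_Arg[of z] by (intro exI[of _ "Arg z"]) (force simp: sgn_eq)

lemma circle_cis_from:
  assumes "z \<in> circle" obtains t where "z = cis t" "x \<le> t" "t < x + 2 * pi"
proof -
  obtain s where s: "z = cis s" using circle_cis assms by blast
  define n where "n = \<lfloor>(s - x) / (2 * pi)\<rfloor>"
  have "n \<le> (s - x) / (2 * pi)" "(s - x) / (2 * pi) < n + 1"
    unfolding n_def by linarith+
  hence "2 * pi * n \<le> s - x" "s - x < 2 * pi * n + 2 * pi"
    by (simp_all add: field_simps)
  hence "x \<le> s + 2 * pi * of_int (-n)" "s + 2 * pi * of_int (-n) < x + 2 * pi" by simp_all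
  thus ?thesis using that s cis_shift by metis
qed

lemma closed_vimage_cis: "closed K \<Longrightarrow> closed (cis -` K)"
  by (intro closed_vimage) (auto intro: continuous_intros)

text \<open>The values lie in the discrete set of multiples of \<open>2 * pi\<close> and the line is
  connected. Applied to a difference of two lifts of one map, this says that lifts are unique up to
  full turns.\<close>

lemma cis_eq_1_const:
  fixes h :: "real \<Rightarrow> real"
  assumes "continuous_on UNIV h" "\<And>t. cis (h t) = 1"
  obtains n :: int where "\<And>t. h t = 2 * pi * n"
proof -
  have v: "\<exists>n::int. h t = 2 * pi * n" for t
    using assms(2)[of t] cis_eq_cis_iff[of "h t" 0] by simp
  have "h constant_on UNIV"
  proof (rule continuous_discrete_range_constant[OF connected_UNIV assms(1)])
    fix x :: real
    have "2 * pi \<le> norm (h y - h x)" if "h y \<noteq> h x" for y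
    proof -
      obtain m n :: int where m: "h y = 2 * pi * m" and n: "h x = 2 * pi * n" using v by metis
      have "1 \<le> \<bar>m - n\<bar>" using that m n by auto
      hence "1 \<le> \<bar>real_of_int (m - n)\<bar>" by linarith
      moreover have "norm (h y - h x) = 2 * pi * \<bar>real_of_int (m - n)\<bar>"
        by (simp add: m n abs_mult flip: right_diff_distrib)
      ultimately show ?thesis by simp
    qed
    thus "\<exists>e>0. \<forall>y. y \<in> UNIV \<and> h y \<noteq> h x \<longrightarrow> e \<le> norm (h y - h x)"
      by (intro exI[of _ "2 * pi"]) auto
  qed
  then obtain c where "\<And>t. h t = c" by (auto simp: constant_on_def)
  with v that show ?thesis by metis
qed

lemma shift_equivariant:
  fixes H :: "real \<Rightarrow> real"
  assumes "\<And>t. H (t + p) = H t + c"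
  shows "H (t + p * of_int n) = H t + c * of_int n"
proof -
  have nat: "H (t + p * real n) = H t + c * real n" for t n
  proof (induction n)
    case (Suc n)
    have "H (t + p * real (Suc n)) = H ((t + p * real n) + p)"
      by (simp add: algebra_simps)
    with Suc show ?case unfolding assms by (simp add: algebra_simps)
  qed simp
  show ?thesis
  proof (cases n)
    case (neg m)
    have n: "real_of_int n = - real (Suc m)" by (simp add: neg)
    have "H t = H ((t + p * of_int n) + p * real (Suc m))" unfolding n by (simp del: of_nat_Suc)
    thus ?thesis unfolding nat unfolding n by (simp add: algebra_simps)
  qed (simp add: nat)
qed

definition lift :: "(complex \<Rightarrow> complex) \<Rightarrow> (real \<Rightarrow> real) \<Rightarrow> bool" where
  "lift f F \<longleftrightarrow> continuous_on UNIV F \<and> (\<forall>t. f (cis t) = cis (F t))"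

text \<open>The line is contractible, so the nowhere vanishing \<open>f \<circ> cis\<close> has a
  continuous logarithm; it is purely imaginary because the values have modulus 1.\<close>

lemma lift_exists:
  assumes "continuous_on circle f" "f ` circle \<subseteq> circle"
  obtains F where "lift f F"
proof -
  have "continuous_on UNIV (f \<circ> cis)"
    by (intro continuous_on_compose continuous_on_subset[OF assms(1)] continuous_intros) auto
  moreover have nz: "f (cis t) \<noteq> 0" "norm (f (cis t)) = 1" for t
    using assms(2) by (auto simp: image_subset_iff dest!: bspec[of _ _ "cis t"])
  ultimately obtain g where g: "continuous_on UNIV g" "\<And>t. f (cis t) = exp (g t)"
    using continuous_logarithm_on_contractible[of UNIV "f \<circ> cis"] by auto
  have "Re (g t) = 0" for t using nz(2)[of t] g(2)[of t] by simp
  hence "f (cis t) = cis (Im (g t))" for t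
    by (simp add: g(2) exp_eq_polar)
  moreover have "continuous_on UNIV (\<lambda>t. Im (g t))" by (intro continuous_intros g)
  ultimately show ?thesis using that by (auto simp: lift_def)
qed

lemma circle_homeosD:
  assumes "f \<in> circle_homeos"
  shows "homeomorphism circle circle f (inv_into circle f)" "bij_betw f circle circle"
    "continuous_on circle f" "f ` circle = circle" "inj_on f circle"
proof -
  obtain g where g: "homeomorphism circle circle f g" using assms by (auto simp: circle_homeos_def)
  show b: "bij_betw f circle circle"
    using g by (metis bij_betw_def homeomorphism_def inj_on_inverseI)
  thus "continuous_on circle f" "f ` circle = circle" "inj_on f circle"
    using g by (auto simp: homeomorphism_def bij_betw_def)
  show "homeomorphism circle circle f (inv_into circle f)"
  proof (rule homeomorphism_cong[OF g])
    fix y assume "y \<in> circle"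
    thus "inv_into circle f y = g y" using g b
      by (metis bij_betw_inv_into_left homeomorphism_def imageI)
  qed auto
qed

text \<open>Composing a lift of a homeomorphism with a lift of its inverse gives a translation,
  which makes the lift bijective and its degree a unit.\<close>

lemma lift_homeo:
  assumes f: "f \<in> circle_homeos" and F: "lift f F"
  shows "bij F"
    and "(strict_mono F \<and> (\<forall>t. F (t + 2 * pi) = F t + 2 * pi)) \<or>
         (strict_antimono_on UNIV F \<and> (\<forall>t. F (t + 2 * pi) = F t - 2 * pi))"
proof -
  note hom = circle_homeosD(1)[OF f]
  obtain G where G: "lift (inv_into circle f) G"
    by (rule lift_exists[of "inv_into circle f"]) (use hom in \<open>auto simp: homeomorphism_def\<close>)
  have cF: "continuous_on UNIV F" and cG: "continuous_on UNIV G"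
    and F': "\<And>t. f (cis t) = cis (F t)" and G': "\<And>t. inv_into circle f (cis t) = cis (G t)"
    using F G by (auto simp: lift_def)
  have cc: "continuous_on UNIV (\<lambda>t. h (k t))"
    if "continuous_on UNIV h" "continuous_on UNIV k" for h k :: "real \<Rightarrow> real"
    using continuous_on_compose2[OF that] by auto
  note diff = continuous_on_diff[OF _ continuous_on_id] cc[of _ "\<lambda>t. t + 2 * pi", OF _ continuous_on_add[OF continuous_on_id continuous_on_const]]
  have inv: "cis (G (F t)) = cis t" "cis (F (G t)) = cis t" for t
    using hom by (simp_all add: homeomorphism_def flip: F' G')
  obtain k :: int where "\<And>t. G (F t) - t = 2 * pi * k"
    by (rule cis_eq_1_const[of "\<lambda>t. G (F t) - t"])
       (simp_all add: inv diff cc cF cG flip: cis_divide)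
  hence k: "G (F t) = t + 2 * pi * k" for t by (metis add.commute diff_add_cancel)
  obtain l :: int where "\<And>t. F (G t) - t = 2 * pi * l"
    by (rule cis_eq_1_const[of "\<lambda>t. F (G t) - t"])
       (simp_all add: inv diff cc cF cG flip: cis_divide)
  hence l: "F (G t) = t + 2 * pi * l" for t by (metis add.commute diff_add_cancel)
  have "inj F" by (rule injI) (metis k add_right_cancel)
  moreover have "surj F"
    by (rule surjI[of _ "\<lambda>t. G (t - 2 * pi * l)"]) (simp add: l)
  ultimately show "bij F" by (simp add: bij_def)
  have per: "\<exists>d::int. \<forall>t. H (t + 2 * pi) = H t + 2 * pi * d"
    if H: "continuous_on UNIV H" "\<And>t. cis (H (t + 2 * pi)) = cis (H t)" for H :: "real \<Rightarrow> real"
  proof -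
    obtain d :: int where "\<And>t. H (t + 2 * pi) - H t = 2 * pi * d"
      by (rule cis_eq_1_const[of "\<lambda>t. H (t + 2 * pi) - H t"])
         (simp_all add: H diff continuous_on_diff flip: cis_divide)
    thus ?thesis by (metis add.commute diff_add_cancel)
  qed
  obtain d :: int where d: "\<And>t. F (t + 2 * pi) = F t + 2 * pi * d"
    using per[of F] cF by (auto simp flip: F')
  obtain e :: int where e: "\<And>t. G (t + 2 * pi) = G t + 2 * pi * e"
    using per[of G] cG by (auto simp flip: G')
  have e_int: "G (t + 2 * pi * of_int n) = G t + 2 * pi * e * of_int n" for t n
    by (rule shift_equivariant) (rule e)
  \<comment> \<open>Degrees multiply under composition and the identity has degree 1, so the
    integers \<open>d\<close> and \<open>e\<close> have product 1.\<close>
  have "G (F (0 + 2 * pi)) = G (F 0) + 2 * pi * e * d" unfolding d e_int by simp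
  hence "2 * pi * 1 = 2 * pi * (e * d)" unfolding k by simp
  hence "real_of_int (e * d) = 1" by simp
  hence "d * e = 1" by (simp only: of_int_eq_1_iff mult.commute)
  hence d1: "d = 1 \<or> d = -1" by (simp add: zmult_eq_1_iff) blast
  have "strict_mono F \<or> strict_antimono_on UNIV F"
    using injective_eq_monotone_map[of UNIV F] \<open>inj F\<close> cF by simp
  moreover have "d = 1" if "strict_mono F"
    using strict_monoD[OF that, of 0 "0 + 2 * pi"] d1 unfolding d by auto
  moreover have "d = -1" if "strict_antimono_on UNIV F"
    using monotone_onD[OF that, of 0 "0 + 2 * pi"] d1 unfolding d by auto
  ultimately show "(strict_mono F \<and> (\<forall>t. F (t + 2 * pi) = F t + 2 * pi)) \<or>
         (strict_antimono_on UNIV F \<and> (\<forall>t. F (t + 2 * pi) = F t - 2 * pi))"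
    using d by auto
qed

lemma circle_homeo_lift:
  assumes "f \<in> circle_homeos" obtains F where "lift f F"
  using lift_exists circle_homeosD[OF assms] by (metis order_refl)

lemma circle_homeos_posI:
  assumes "f \<in> circle_homeos" "lift f F" "strict_mono F"
  shows "f \<in> circle_homeos_pos"
  using assms by (auto simp: circle_homeos_pos_def lift_def)

lemma circle_homeos_pos_lift:
  assumes "f \<in> circle_homeos_pos"
  obtains F where "f \<in> circle_homeos" "lift f F" "strict_mono F" "\<And>t. F (t + 2 * pi) = F t + 2 * pi"
proof -
  obtain F where F: "f \<in> circle_homeos" "lift f F" "strict_mono F"
    using assms by (auto simp: circle_homeos_pos_def lift_def)
  have "\<not> strict_antimono_on UNIV F"
    using strict_monoD[OF F(3), of 0 1] monotone_onD[of UNIV "(<)" "(>)" F 0 1] by auto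
  with lift_homeo(2)[OF F(1,2)] F that show ?thesis by blast
qed

section \<open>Gaps between sets of different colours\<close>

lemma closed_last_point:
  fixes S :: "real set"
  assumes "closed S" "s \<in> S" "s \<le> y"
  obtains u where "u \<in> S" "s \<le> u" "u \<le> y" "\<And>t. t \<in> S \<Longrightarrow> t \<le> y \<Longrightarrow> t \<le> u"
proof -
  have "compact ({s..y} \<inter> S)" using assms by (intro compact_Int_closed) auto
  moreover have "{s..y} \<inter> S \<noteq> {}" using assms by auto
  ultimately obtain u where u: "u \<in> {s..y} \<inter> S" "\<forall>t\<in>{s..y} \<inter> S. t \<le> u"
    using compact_attains_sup by blast
  have "t \<le> u" if "t \<in> S" "t \<le> y" for t using that u by (cases "s \<le> t") auto
  thus ?thesis using that u by auto
qed

lemma closed_first_point: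
  fixes S :: "real set"
  assumes "closed S" "s \<in> S" "y \<le> s"
  obtains u where "u \<in> S" "u \<le> s" "y \<le> u" "\<And>t. t \<in> S \<Longrightarrow> y \<le> t \<Longrightarrow> u \<le> t"
proof -
  have "closed (uminus -` S)" by (intro closed_vimage assms continuous_intros)
  then obtain u where "- u \<in> S" "- s \<le> u" "u \<le> - y" "\<And>t. - t \<in> S \<Longrightarrow> t \<le> - y \<Longrightarrow> t \<le> u"
    using closed_last_point[of "uminus -` S" "- s" "- y"] assms by auto
  thus ?thesis using that[of "- u"]
    by (metis add.inverse_inverse minus_le_iff neg_le_iff_le)
qed

text \<open>The chord has length \<open>2 * \<bar>sin ((a - b) / 2)\<bar>\<close>, at most that of
  the arc.\<close>

lemma norm_cis_diff_le: "norm (cis a - cis b) \<le> \<bar>a - b\<bar>"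
proof -
  have "(norm (cis a - cis b))\<^sup>2 = (cos a - cos b)\<^sup>2 + (sin a - sin b)\<^sup>2"
    by (simp add: cmod_power2)
  also have "\<dots> = ((sin a)\<^sup>2 + (cos a)\<^sup>2) + ((sin b)\<^sup>2 + (cos b)\<^sup>2) - 2 * cos (a - b)"
    by (simp add: power2_eq_square cos_diff algebra_simps)
  also have "\<dots> = (2 * sin ((a - b) / 2))\<^sup>2"
    using cos_double_sin[of "(a - b) / 2"] by (simp add: power_mult_distrib diff_divide_distrib)
  also have "\<dots> \<le> \<bar>a - b\<bar>\<^sup>2"
    using abs_sin_x_le_abs_x[of "(a - b) / 2"] by (subst abs_le_square_iff[symmetric]) (simp add: abs_mult)
  finally show ?thesis by (rule power2_le_imp_le) simp
qed

text \<open>Only the colours enter here, the maps come later: the same geometry serves finite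
  collections of minimal sets, triples \<open>{A, B, C}\<close> and pairs
  \<open>{M, K 0}\<close>.\<close>

locale coloured =
  fixes KK :: "complex set set"
  assumes finite_KK: "finite KK"
    and closed_KK: "K \<in> KK \<Longrightarrow> closed K"
    and circle_KK: "K \<in> KK \<Longrightarrow> K \<subseteq> circle"
    and disjoint_KK: "K \<in> KK \<Longrightarrow> L \<in> KK \<Longrightarrow> z \<in> K \<Longrightarrow> z \<in> L \<Longrightarrow> K = L"
begin

text \<open>Gaps live on the line, together with all their translates by full turns, so that left
  and right make sense. The condition \<open>K \<noteq> L\<close> leaves out complementary arcs with
  both ends in one colour, of which there may be infinitely many.\<close>

definition gap :: "complex set \<Rightarrow> complex set \<Rightarrow> real \<Rightarrow> real \<Rightarrow> bool" where
  "gap K L a b \<longleftrightarrow> K \<in> KK \<and> L \<in> KK \<and> K \<noteq> L \<and> cis a \<in> K \<and> cis b \<in> L \<and> a < b \<and>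
     (\<forall>t. a < t \<longrightarrow> t < b \<longrightarrow> cis t \<notin> \<Union>KK)"

lemma closed_vimage_Union: "KK' \<subseteq> KK \<Longrightarrow> closed (cis -` \<Union>KK')"
  using finite_KK closed_KK by (intro closed_vimage_cis closed_Union) (auto intro: finite_subset)

lemma gap_after:
  assumes "K \<in> KK" "L \<in> KK" "K \<noteq> L" "cis x \<in> K" "cis y \<in> L" "x < y"
  obtains L' a b where "gap K L' a b" "x \<le> a" "b \<le> y"
proof -
  obtain u where u: "cis u \<in> K" "x \<le> u" "u \<le> y" "\<And>t. cis t \<in> K \<Longrightarrow> t \<le> y \<Longrightarrow> t \<le> u"
    using closed_last_point[of "cis -` K" x y] closed_vimage_cis[OF closed_KK[OF assms(1)]] assms by auto
  have "cis y \<in> \<Union>(KK - {K})" using assms by auto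
  moreover have "closed (cis -` \<Union>(KK - {K}))" by (rule closed_vimage_Union) auto
  ultimately obtain v where v: "cis v \<in> \<Union>(KK - {K})" "v \<le> y" "u \<le> v"
    "\<And>t. cis t \<in> \<Union>(KK - {K}) \<Longrightarrow> u \<le> t \<Longrightarrow> v \<le> t"
    using closed_first_point[of "cis -` \<Union>(KK - {K})" y u] u(3) by (auto simp del: Union_iff)
  obtain L' where L': "L' \<in> KK" "L' \<noteq> K" "cis v \<in> L'" using v(1) by blast
  have "u \<noteq> v" using L' u(1) disjoint_KK assms(1) by blast
  have "gap K L' u v" unfolding gap_def
  proof (intro conjI allI impI notI)
    fix t assume t: "u < t" "t < v" "cis t \<in> \<Union>KK"
    hence "cis t \<in> K \<or> cis t \<in> \<Union>(KK - {K})" by blast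
    thus False using t u(4)[of t] v(2) v(4)[of t] by force
  qed (use \<open>u \<noteq> v\<close> v(3) u(1) L' assms(1) in auto)
  thus ?thesis using that u v by blast
qed

text \<open>The gap runs from the last point of another colour to the first point of
  \<open>L\<close> after \<open>x\<close>. The final clause makes it the first entry into
  \<open>L\<close>; \<open>card_minimal_le\<close> compares such entries.\<close>

lemma gap_before:
  assumes "K \<in> KK" "L \<in> KK" "K \<noteq> L" "cis x \<in> K" "cis y \<in> L" "x < y"
  obtains K' a b where "gap K' L a b" "x \<le> a" "b \<le> y" "\<And>t. x \<le> t \<Longrightarrow> t < b \<Longrightarrow> cis t \<notin> L"
proof -
  have "closed (cis -` L)" using closed_vimage_cis closed_KK assms(2) by blast
  then obtain v where v: "cis v \<in> L" "v \<le> y" "x \<le> v" "\<And>t. cis t \<in> L \<Longrightarrow> x \<le> t \<Longrightarrow> v \<le> t"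
    using closed_first_point[of "cis -` L" y x] assms by auto
  have "cis x \<in> \<Union>(KK - {L})" using assms by auto
  moreover have "closed (cis -` \<Union>(KK - {L}))" by (rule closed_vimage_Union) auto
  ultimately obtain u where u: "cis u \<in> \<Union>(KK - {L})" "x \<le> u" "u \<le> v"
    "\<And>t. cis t \<in> \<Union>(KK - {L}) \<Longrightarrow> t \<le> v \<Longrightarrow> t \<le> u"
    using closed_last_point[of "cis -` \<Union>(KK - {L})" x v] v(3) by (auto simp del: Union_iff)
  obtain K' where K': "K' \<in> KK" "K' \<noteq> L" "cis u \<in> K'" using u(1) by blast
  have "u \<noteq> v" using K' v(1) disjoint_KK assms(2) by blast
  have "gap K' L u v" unfolding gap_def
  proof (intro conjI allI impI notI)
    fix t assume t: "u < t" "t < v" "cis t \<in> \<Union>KK"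
    hence "cis t \<in> L \<or> cis t \<in> \<Union>(KK - {L})" by blast
    thus False using t v(4)[of t] u(2) u(4)[of t] by force
  qed (use \<open>u \<noteq> v\<close> u(3) v(1) K' assms(2) in auto)
  moreover have "cis t \<notin> L" if "x \<le> t" "t < v" for t using v(4)[of t] that by auto
  ultimately show ?thesis using that u v by blast
qed

lemma gap_shift: "gap K L a b \<Longrightarrow> gap K L (a + 2 * pi * of_int n) (b + 2 * pi * of_int n)"
proof -
  assume g: "gap K L a b"
  have "cis t \<notin> \<Union>KK" if "a + 2 * pi * of_int n < t" "t < b + 2 * pi * of_int n" for t
  proof -
    have "a < t + 2 * pi * of_int (- n)" "t + 2 * pi * of_int (- n) < b" using that by auto
    with g have "cis (t + 2 * pi * of_int (- n)) \<notin> \<Union>KK" unfolding gap_def by blast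
    thus ?thesis unfolding cis_shift .
  qed
  thus ?thesis using g by (auto simp: gap_def)
qed

text \<open>Ends of gaps are coloured and interiors are not, so neither gap can have an end inside
  the other.\<close>

lemma gap_unique:
  assumes "gap K L a b" "gap K' L' a' b'" "a < b'" "a' < b"
  shows "a = a'" "b = b'" "K = K'" "L = L'"
proof -
  have "cis a' \<in> \<Union>KK" "cis a \<in> \<Union>KK" "cis b' \<in> \<Union>KK" "cis b \<in> \<Union>KK"
    using assms by (auto simp: gap_def)
  thus "a = a'" "b = b'" using assms unfolding gap_def by (metis linorder_less_linear)+
  thus "K = K'" "L = L'" using assms disjoint_KK unfolding gap_def by metis+
qed

text \<open>The point \<open>a + 2 * pi\<close> has the colour of \<open>a\<close>: it can neither
  lie inside the gap nor be its right end.\<close>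

lemma gap_length: assumes "gap K L a b" shows "b < a + 2 * pi"
proof (rule ccontr)
  assume "\<not> b < a + 2 * pi"
  moreover have "cis (a + 2 * pi) \<in> \<Union>KK" using assms by (auto simp: gap_def)
  moreover have "b \<noteq> a + 2 * pi" using assms disjoint_KK by (force simp: gap_def)
  ultimately show False using assms unfolding gap_def
    by (metis less_add_same_cancel1 linorder_neqE_linordered_idom pi_gt_zero mult_pos_pos zero_less_numeral)
qed

lemma gap_separation:
  obtains \<delta> where "\<delta> > 0" "\<And>K L a b. gap K L a b \<Longrightarrow> a + \<delta> \<le> b"
proof -
  have "\<exists>d>0. \<forall>x\<in>K. \<forall>y\<in>\<Union>(KK - {K}). d \<le> dist x y" if "K \<in> KK" for K
  proof (rule separate_compact_closed)
    show "compact K" using that closed_KK circle_KK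
      by (metis compact_Int_closed compact_sphere inf.absorb_iff2)
    show "closed (\<Union>(KK - {K}))" using finite_KK closed_KK by (intro closed_Union) auto
    show "K \<inter> \<Union>(KK - {K}) = {}" using disjoint_KK that by blast
  qed
  then obtain d where d: "\<And>K. K \<in> KK \<Longrightarrow> d K > 0"
    "\<And>K x y. K \<in> KK \<Longrightarrow> x \<in> K \<Longrightarrow> y \<in> \<Union>(KK - {K}) \<Longrightarrow> d K \<le> dist x y" by metis
  \<comment> \<open>The inserted 1 keeps the minimum meaningful when \<open>KK\<close> is
    empty.\<close>
  define \<delta> :: real where "\<delta> = Min (insert 1 (d ` KK))"
  have "\<delta> > 0" unfolding \<delta>_def using finite_KK d(1) by (subst Min_gr_iff) auto
  moreover have "a + \<delta> \<le> b" if "gap K L a b" for K L a b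
  proof -
    have "K \<in> KK" "cis a \<in> K" "cis b \<in> \<Union>(KK - {K})" "a < b" using that by (auto simp: gap_def)
    have "\<delta> \<le> d K" unfolding \<delta>_def using \<open>K \<in> KK\<close> finite_KK by (intro Min_le) auto
    also have "\<dots> \<le> dist (cis a) (cis b)" by (intro d) fact+
    also have "\<dots> \<le> b - a" using norm_cis_diff_le[of a b] \<open>a < b\<close> by (simp add: dist_norm)
    finally show ?thesis by simp
  qed
  ultimately show ?thesis by (rule that)
qed

section \<open>Finitely many gaps modulo full turns, and the closed sets they sweep out\<close>

definition gaps :: "(real \<times> real) set" where
  "gaps = {(a, b). 0 \<le> a \<and> a < 2 * pi \<and> (\<exists>K L. gap K L a b)}"

text \<open>Gaps have length at least \<delta>, so two of them whose left ends fall into the same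
  cell of a subdivision of step \<delta> overlap and coincide.\<close>

lemma finite_gaps: "finite gaps"
proof -
  obtain \<delta> where \<delta>: "\<delta> > 0" "\<And>K L a b. gap K L a b \<Longrightarrow> a + \<delta> \<le> b" by (rule gap_separation) blast
  have "inj_on (\<lambda>(a, b). \<lfloor>a / \<delta>\<rfloor>) gaps"
  proof (rule inj_onI, clarify)
    fix a b a' b' assume *: "(a, b) \<in> gaps" "(a', b') \<in> gaps" "\<lfloor>a / \<delta>\<rfloor> = \<lfloor>a' / \<delta>\<rfloor>"
    then obtain K L K' L' where g: "gap K L a b" "gap K' L' a' b'" by (auto simp: gaps_def)
    have "\<bar>a / \<delta> - a' / \<delta>\<bar> < 1" using *(3) by linarith
    hence "\<bar>a - a'\<bar> < \<delta>" using \<delta>(1) by (simp add: field_simps flip: diff_divide_distrib)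
    hence "a < b'" "a' < b" using \<delta>(2) g by fastforce+
    thus "a = a' \<and> b = b'" using gap_unique[OF g] by simp
  qed
  moreover have "(\<lambda>(a, b). \<lfloor>a / \<delta>\<rfloor>) ` gaps \<subseteq> {0..\<lfloor>2 * pi / \<delta>\<rfloor>}"
    using \<delta>(1) by (auto simp: gaps_def intro!: floor_mono divide_right_mono)
  ultimately show ?thesis using finite_imageD finite_subset by blast
qed

lemma gap_normalize:
  assumes "gap K L a b"
  obtains n :: int where "(a + 2 * pi * of_int n, b + 2 * pi * of_int n) \<in> gaps"
proof -
  obtain s where s: "cis a = cis s" "0 \<le> s" "s < 0 + 2 * pi"
    using circle_cis_from[of "cis a" 0] by auto
  then obtain n :: int where n: "s = a + 2 * pi * n" using cis_eq_cis_iff by metis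
  show ?thesis using that[of n] s gap_shift[OF assms, of n] by (auto simp: gaps_def n)
qed

text \<open>Indexing by a set of ordered pairs lets one definition serve both counts: a symmetric
  \<open>T\<close> for an unordered type, and all pairs with a given right colour. The ends are
  included to make the union closed.\<close>

definition gap_union :: "(complex set \<times> complex set) set \<Rightarrow> complex set" where
  "gap_union T = \<Union>{cis ` {a..b} | a b K L. gap K L a b \<and> (K, L) \<in> T}"

lemma gap_unionI: "gap K L a b \<Longrightarrow> (K, L) \<in> T \<Longrightarrow> a \<le> t \<Longrightarrow> t \<le> b \<Longrightarrow> cis t \<in> gap_union T"
  unfolding gap_union_def by (rule UnionI[of "cis ` {a..b}"]) auto

lemma gap_unionE:
  assumes "z \<in> gap_union T"
  obtains K L a b t where "(a, b) \<in> gaps" "gap K L a b" "(K, L) \<in> T" "a \<le> t" "t \<le> b" "z = cis t"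
proof -
  obtain K L a b t where *: "gap K L a b" "(K, L) \<in> T" "a \<le> t" "t \<le> b" "z = cis t"
    using assms unfolding gap_union_def by auto
  obtain n :: int where "(a + 2 * pi * of_int n, b + 2 * pi * of_int n) \<in> gaps"
    using gap_normalize *(1) by blast
  moreover note gap_shift[OF *(1), of n]
  ultimately show ?thesis using * by (intro that[of _ _ K L "t + 2 * pi * of_int n"]) auto
qed

lemma gap_union_circle: "gap_union T \<subseteq> circle"
  by (auto elim: gap_unionE)

lemma closed_gap_union: "closed (gap_union T)"
proof -
  define G where "G = {(a, b) \<in> gaps. \<exists>K L. gap K L a b \<and> (K, L) \<in> T}"
  have "gap_union T = (\<Union>(a, b)\<in>G. cis ` {a..b})"
  proof (intro equalityI subsetI)
    fix z assume "z \<in> gap_union T"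
    then obtain K L a b t where "(a, b) \<in> gaps" "gap K L a b" "(K, L) \<in> T" "a \<le> t" "t \<le> b" "z = cis t"
      by (rule gap_unionE)
    thus "z \<in> (\<Union>(a, b)\<in>G. cis ` {a..b})" unfolding G_def by force
  qed (auto simp: G_def intro: gap_unionI)
  moreover have "finite G" using finite_gaps by (rule finite_subset[rotated]) (auto simp: G_def)
  moreover have "closed (cis ` {a..b})" for a b
    by (intro compact_imp_closed compact_continuous_image continuous_intros) auto
  ultimately show ?thesis by auto
qed

text \<open>Gaps with different colour pairs have disjoint interiors, so their closures meet in end
  points only.\<close>

lemma finite_gap_union_Int:
  assumes "T \<inter> T' = {}"
  shows "finite (gap_union T \<inter> gap_union T')"
proof (rule finite_subset)
  show "finite (cis ` fst ` gaps \<union> cis ` snd ` gaps)" using finite_gaps by auto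
  show "gap_union T \<inter> gap_union T' \<subseteq> cis ` fst ` gaps \<union> cis ` snd ` gaps"
  proof clarify
    fix z assume "z \<in> gap_union T" "z \<in> gap_union T'" and nz: "z \<notin> cis ` snd ` gaps"
    then obtain K L a b t K' L' a' b' t' where
      g: "(a, b) \<in> gaps" "gap K L a b" "(K, L) \<in> T" "a \<le> t" "t \<le> b" "z = cis t" and
      g': "gap K' L' a' b'" "(K', L') \<in> T'" "a' \<le> t'" "t' \<le> b'" "z = cis t'"
      by (metis gap_unionE)
    obtain n :: int where n: "t = t' + 2 * pi * n" using g g' cis_eq_cis_iff by metis
    note gn = gap_shift[OF g'(1), of n]
    have "t = a"
    proof (rule ccontr)
      assume "t \<noteq> a"
      moreover have "t \<noteq> b" using nz g(1,6) by force
      ultimately have "a < b' + 2 * pi * of_int n" "a' + 2 * pi * of_int n < b" using g g' n by auto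
      from gap_unique(3,4)[OF g(2) gn this] show False using g(3) g'(2) assms by auto
    qed
    thus "z \<in> cis ` fst ` gaps" using g(1,6) by force
  qed
qed

subsection \<open>Homeomorphisms permute the gaps\<close>

context
  fixes f F
  assumes f: "f \<in> circle_homeos" and F: "lift f F"
    and inv: "\<And>K. K \<in> KK \<Longrightarrow> f ` K \<subseteq> K"
begin

private lemma cisF: "K \<in> KK \<Longrightarrow> cis a \<in> K \<Longrightarrow> cis (F a) \<in> K"
  using inv F by (fastforce simp: lift_def)

private lemma image_mono:
  assumes "strict_mono F" shows "F ` {a..b} = {F a..F b}"
proof safe
  fix y assume "y \<in> {F a..F b}"
  moreover obtain x where "y = F x" using lift_homeo(1)[OF f F] by (metis bij_pointE)
  ultimately show "y \<in> F ` {a..b}" using strict_mono_less_eq[OF assms] by auto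
qed (auto simp: strict_mono_less_eq[OF assms])

private lemma image_antimono:
  assumes "strict_antimono_on UNIV F" shows "F ` {a..b} = {F b..F a}"
proof -
  have le: "F x \<le> F y \<longleftrightarrow> y \<le> x" for x y
    using monotone_onD[OF assms, of x y] monotone_onD[OF assms, of y x]
    by (cases x y rule: linorder_cases) auto
  show ?thesis
  proof safe
    fix y assume "y \<in> {F b..F a}"
    moreover obtain x where "y = F x" using lift_homeo(1)[OF f F] by (metis bij_pointE)
    ultimately show "y \<in> F ` {a..b}" using le by auto
  qed (auto simp: le)
qed

text \<open>The lift has degree 1 or -1, so \<open>m\<close> is \<open>n\<close> or
  \<open>- n\<close> according to orientation.\<close>

private lemma F_shift: "\<exists>m::int. \<bar>m\<bar> = \<bar>n\<bar> \<and> (\<forall>t. F (t + 2 * pi * of_int m) = F t + 2 * pi * of_int n)"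
proof -
  consider "\<And>t. F (t + 2 * pi) = F t + 2 * pi" | "\<And>t. F (t + 2 * pi) = F t + (- 2 * pi)"
    using lift_homeo(2)[OF f F] by force
  thus ?thesis
  proof cases
    case 1 show ?thesis using shift_equivariant[of F, OF 1, of _ n] by (intro exI[of _ n]) auto
  next
    case 2 show ?thesis using shift_equivariant[of F, OF 2, of _ "- n"] by (intro exI[of _ "- n"]) auto
  qed
qed

private lemma covers_shift:
  assumes "gap K L a b" "{a'..b'} \<subseteq> F ` {a..b}"
  obtains m :: int where "gap K L (a + 2 * pi * of_int m) (b + 2 * pi * of_int m)"
    "{a' + 2 * pi * of_int n..b' + 2 * pi * of_int n} \<subseteq> F ` {a + 2 * pi * of_int m..b + 2 * pi * of_int m}"
proof -
  obtain m :: int where m: "\<And>t. F (t + 2 * pi * of_int m) = F t + 2 * pi * of_int n"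
    using F_shift by blast
  have "{a' + 2 * pi * of_int n..b' + 2 * pi * of_int n} \<subseteq> F ` {a + 2 * pi * of_int m..b + 2 * pi * of_int m}"
  proof
    fix y assume "y \<in> {a' + 2 * pi * of_int n..b' + 2 * pi * of_int n}"
    hence "y - 2 * pi * of_int n \<in> {a'..b'}" by auto
    then obtain x where "x \<in> {a..b}" "y - 2 * pi * of_int n = F x" using assms(2) by blast
    thus "y \<in> F ` {a + 2 * pi * of_int m..b + 2 * pi * of_int m}"
      using m[of x] by (intro image_eqI[of _ _ "x + 2 * pi * of_int m"]) auto
  qed
  thus ?thesis using that gap_shift[OF assms(1)] by blast
qed

text \<open>The image of a gap joins two colours, so it covers a gap. As there are only finitely many
  gaps modulo \<open>2\<pi>\<close>, this injective assignment is a bijection; hence each gap is covered, and the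
  covering arc contains no further gap, so that the colours at the ends agree.\<close>

private definition covers :: "complex \<Rightarrow> complex \<Rightarrow> bool" where
  "covers p p' \<longleftrightarrow> (\<exists>K L a b K' L' a' b'. gap K L a b \<and> gap K' L' a' b' \<and> p = cis a \<and> p' = cis a' \<and>
     {a'..b'} \<subseteq> F ` {a..b})"

text \<open>A gap modulo full turns is represented by its left end on the circle, which determines
  it by \<open>gap_unique\<close>.\<close>

private definition ends :: "complex set" where
  "ends = {cis a | a. \<exists>K L b. gap K L a b}"

private lemma coversI:
  "gap K L a b \<Longrightarrow> gap K' L' a' b' \<Longrightarrow> {a'..b'} \<subseteq> F ` {a..b} \<Longrightarrow> covers (cis a) (cis a')"
  unfolding covers_def by blast

private lemma covers_ends: "covers p p' \<Longrightarrow> p \<in> ends \<and> p' \<in> ends"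
  by (auto simp: covers_def ends_def)

private lemma finite_ends: "finite ends"
proof (rule finite_subset)
  show "ends \<subseteq> cis ` fst ` gaps"
  proof
    fix z assume "z \<in> ends"
    then obtain K L a b where "gap K L a b" "z = cis a" by (auto simp: ends_def)
    moreover from this obtain n :: int where "(a + 2 * pi * of_int n, b + 2 * pi * of_int n) \<in> gaps"
      using gap_normalize by blast
    ultimately show "z \<in> cis ` fst ` gaps" by (metis cis_shift fst_conv imageI)
  qed
qed (use finite_gaps in auto)

private lemma covers_total: assumes "p \<in> ends" shows "\<exists>p'. covers p p'"
proof -
  obtain K L a b where g: "gap K L a b" "p = cis a" using assms by (auto simp: ends_def)
  hence c: "cis (F a) \<in> K" "cis (F b) \<in> L" "a < b" "K \<in> KK" "L \<in> KK" "K \<noteq> L"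
    using cisF by (auto simp: gap_def)
  have "\<exists>K' L' a' b'. gap K' L' a' b' \<and> {a'..b'} \<subseteq> F ` {a..b}"
    using lift_homeo(2)[OF f F]
  proof (elim disjE conjE)
    assume F: "strict_mono F"
    from strict_monoD[OF this c(3)] obtain L' a' b' where "gap K L' a' b'" "F a \<le> a'" "b' \<le> F b"
      using gap_after[of K L "F a" "F b"] c by metis
    thus ?thesis unfolding image_mono[OF F] by fastforce
  next
    assume F: "strict_antimono_on UNIV F"
    from monotone_onD[OF this, of a b] c obtain L' a' b' where "gap L L' a' b'" "F b \<le> a'" "b' \<le> F a"
      using gap_after[of L K "F b" "F a"] by auto
    thus ?thesis unfolding image_antimono[OF F] by fastforce
  qed
  thus ?thesis using g coversI by blast
qed

private lemma covers_inj: assumes "covers p q" "covers p' q" shows "p = p'"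
proof -
  obtain K L a b K1 L1 a1 b1 where 1: "gap K L a b" "gap K1 L1 a1 b1" "p = cis a" "q = cis a1"
    "{a1..b1} \<subseteq> F ` {a..b}" using assms(1) by (auto simp: covers_def)
  obtain K' L' a' b' K2 L2 a2 b2 where 2: "gap K' L' a' b'" "gap K2 L2 a2 b2" "p' = cis a'" "q = cis a2"
    "{a2..b2} \<subseteq> F ` {a'..b'}" using assms(2) by (auto simp: covers_def)
  obtain n :: int where n: "a1 = a2 + 2 * pi * n" using 1 2 cis_eq_cis_iff by metis
  obtain m :: int where m: "gap K' L' (a' + 2 * pi * of_int m) (b' + 2 * pi * of_int m)"
    "{a2 + 2 * pi * of_int n..b2 + 2 * pi * of_int n} \<subseteq> F ` {a' + 2 * pi * of_int m..b' + 2 * pi * of_int m}"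
    using covers_shift[OF 2(1,5)] by metis
  \<comment> \<open>The two distinct points \<open>a1\<close> and \<open>e\<close> lie in both
    copies of the covered gap. A single common preimage would only show that the two covering gaps
    touch.\<close>
  define e where "e = min b1 (b2 + 2 * pi * of_int n)"
  have e: "a1 < e" "e \<in> {a1..b1}" "e \<in> {a2 + 2 * pi * of_int n..b2 + 2 * pi * of_int n}"
    "a1 \<in> {a1..b1}" "a1 \<in> {a2 + 2 * pi * of_int n..b2 + 2 * pi * of_int n}"
    using 1(2) 2(2) by (auto simp: e_def n gap_def)
  have "inj F" using lift_homeo(1)[OF f F] by (simp add: bij_is_inj)
  hence Fm: "F x \<in> F ` A \<Longrightarrow> x \<in> A" for x A by (simp add: inj_image_mem_iff)
  obtain x y where xy: "F x = e" "F y = a1" using lift_homeo(1)[OF f F] by (metis bij_pointE)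
  have "x \<in> {a..b}" "y \<in> {a..b}" "x \<in> {a' + 2 * pi * of_int m..b' + 2 * pi * of_int m}"
    "y \<in> {a' + 2 * pi * of_int m..b' + 2 * pi * of_int m}"
    using subsetD[OF 1(5) e(2)] subsetD[OF 1(5) e(4)] subsetD[OF m(2) e(3)] subsetD[OF m(2) e(5)]
    unfolding xy[symmetric] by (blast intro: Fm)+
  moreover have "x \<noteq> y" using xy e by auto
  ultimately have "a < b' + 2 * pi * of_int m" "a' + 2 * pi * of_int m < b" by auto
  from gap_unique(1)[OF 1(1) m(1) this] show ?thesis by (simp add: 1 2)
qed

private lemma covers_bij:
  shows covers_surj: "q \<in> ends \<Longrightarrow> \<exists>p. covers p q"
    and covers_fun: "covers p q \<Longrightarrow> covers p q' \<Longrightarrow> q = q'"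
proof -
  obtain \<phi> where \<phi>: "\<And>p. p \<in> ends \<Longrightarrow> covers p (\<phi> p)" using covers_total by metis
  have "inj_on \<phi> ends" by (rule inj_onI) (metis \<phi> covers_inj)
  moreover have "\<phi> ` ends \<subseteq> ends" using \<phi> covers_ends by blast
  ultimately have s: "\<phi> ` ends = ends" using finite_ends by (metis endo_inj_surj)
  have sp: "\<exists>p. q = \<phi> p \<and> covers p q" if "q \<in> ends" for q using s \<phi> that by (metis imageE)
  thus "q \<in> ends \<Longrightarrow> \<exists>p. covers p q" by blast
  show "covers p q \<Longrightarrow> covers p q' \<Longrightarrow> q = q'" using sp covers_inj covers_ends by metis
qed

lemma gap_pullback:
  assumes g': "gap K' L' a' b'"
  obtains K L a b where "gap K L a b" "{a'..b'} \<subseteq> F ` {a..b}"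
    "(strict_mono F \<and> K = K' \<and> L = L') \<or> (strict_antimono_on UNIV F \<and> K = L' \<and> L = K')"
proof -
  have "cis a' \<in> ends" using g' by (auto simp: ends_def)
  then obtain p where "covers p (cis a')" using covers_surj by blast
  then obtain K L a0 b0 K1 L1 a1 b1 where 1: "gap K L a0 b0" "gap K1 L1 a1 b1" "cis a' = cis a1"
    "{a1..b1} \<subseteq> F ` {a0..b0}" by (auto simp: covers_def)
  obtain n :: int where n: "a' = a1 + 2 * pi * n" using 1 cis_eq_cis_iff by metis
  have "b' = b1 + 2 * pi * n"
    using gap_unique(2)[OF g' gap_shift[OF 1(2), of n]] n g' 1(2) by (auto simp: gap_def)
  then obtain a b where g: "gap K L a b" and sub: "{a'..b'} \<subseteq> F ` {a..b}"
    using covers_shift[OF 1(1,4), of n] n by metis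
  \<comment> \<open>\<open>covers_fun\<close> identifies the gaps up to full turns only. The shift
    \<open>k\<close> vanishes because the preimages of \<open>c\<close> and \<open>a'\<close> in
    \<open>{a..b}\<close> are \<bar>k\<bar> turns apart, and a gap is shorter than one turn.\<close>
  have only: "c = a'" if cd: "gap M N c d" "{c..d} \<subseteq> F ` {a..b}" for M N c d
  proof -
    have "cis c = cis a'" using covers_fun coversI[OF g g' sub] coversI[OF g cd] by blast
    then obtain k :: int where k: "c = a' + 2 * pi * k" using cis_eq_cis_iff by metis
    have "c \<in> F ` {a..b}" "a' \<in> F ` {a..b}" using cd sub g' less_imp_le[of c d] less_imp_le[of a' b'] unfolding gap_def
      by (meson atLeastAtMost_iff order_refl subsetD)+
    then obtain s t where st: "s \<in> {a..b}" "t \<in> {a..b}" "c = F s" "a' = F t" by blast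
    obtain m :: int where m: "\<bar>m\<bar> = \<bar>k\<bar>" "F (t + 2 * pi * of_int m) = F t + 2 * pi * of_int k"
      using F_shift[of k] by blast
    have "inj F" using lift_homeo(1)[OF f F] by (simp add: bij_is_inj)
    hence "s = t + 2 * pi * of_int m" using st k m(2) by (metis injD)
    hence "\<bar>2 * pi * of_int m\<bar> < 2 * pi" using st gap_length[OF g] by auto
    hence "\<bar>real_of_int m\<bar> < 1" by (simp add: abs_mult)
    hence "k = 0" using m by linarith
    thus ?thesis using k by simp
  qed
  have KL: "cis (F a) \<in> K" "cis (F b) \<in> L" "K \<in> KK" "L \<in> KK" using g cisF by (auto simp: gap_def)
  have KL': "cis a' \<in> K'" "cis b' \<in> L'" "K' \<in> KK" "L' \<in> KK" "a' < b'" using g' by (auto simp: gap_def)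
  \<comment> \<open>A colour other than \<open>K'\<close> at \<open>x\<close> would produce a second
    covered gap between \<open>x\<close> and \<open>a'\<close>. Which end of \<open>{a..b}\<close>
    is mapped to \<open>x\<close> depends on orientation, hence the general
    \<open>M\<close>.\<close>
  have left: "M = K'" if M: "M \<in> KK" "cis x \<in> M" "x \<le> a'" "{x..a'} \<subseteq> F ` {a..b}" for M x
  proof (rule ccontr)
    assume "M \<noteq> K'"
    moreover from this have "x \<noteq> a'" using M KL' disjoint_KK by blast
    ultimately obtain N c d where cd: "gap M N c d" "x \<le> c" "d \<le> a'" using M KL' gap_after[of M K' x a'] by force
    have "{c..d} \<subseteq> {x..a'}" using cd by auto
    hence "c = a'" using only[OF cd(1)] M(4) by blast
    thus False using cd unfolding gap_def by linarith
  qed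
  have right: "M = L'" if M: "M \<in> KK" "cis x \<in> M" "b' \<le> x" "{b'..x} \<subseteq> F ` {a..b}" for M x
  proof (rule ccontr)
    assume "M \<noteq> L'"
    moreover from this have "x \<noteq> b'" using M KL' disjoint_KK by blast
    ultimately obtain N c d where cd: "gap L' N c d" "b' \<le> c" "d \<le> x" using M KL' gap_after[of L' M b' x] by force
    have "{c..d} \<subseteq> {b'..x}" using cd by auto
    hence "c = a'" using only[OF cd(1)] M(4) by blast
    thus False using cd KL' by auto
  qed
  from lift_homeo(2)[OF f F] show ?thesis
  proof (elim disjE conjE)
    assume F: "strict_mono F"
    have "F a \<le> a'" "b' \<le> F b" using sub KL'(5) by (auto simp: image_mono[OF F])
    thus ?thesis using left[of K "F a"] right[of L "F b"] KL KL'(5) g sub F that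
      unfolding image_mono[OF F] by auto
  next
    assume F: "strict_antimono_on UNIV F"
    have "F b \<le> a'" "b' \<le> F a" using sub KL'(5) by (auto simp: image_antimono[OF F])
    thus ?thesis using left[of L "F b"] right[of K "F a"] KL KL'(5) g sub F that
      unfolding image_antimono[OF F] by auto
  qed
qed

end

text \<open>A point of a gap is pulled back into the covering gap given by
  \<open>gap_pullback\<close>. Reversal swaps the two colours, which a symmetric \<open>T\<close>
  tolerates.\<close>

lemma gap_union_backward:
  assumes f: "f \<in> circle_homeos" and inv: "\<And>K. K \<in> KK \<Longrightarrow> f ` K \<subseteq> K"
    and T: "sym T \<or> f \<in> circle_homeos_pos"
  shows "inv_into circle f ` gap_union T \<subseteq> gap_union T"
proof -
  obtain F where F: "lift f F" "\<not> sym T \<Longrightarrow> strict_mono F"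
    using T circle_homeo_lift[OF f] circle_homeos_pos_lift by metis
  have "inv_into circle f (cis t) \<in> gap_union T"
    if g': "gap K' L' a' b'" and T': "(K', L') \<in> T" and t: "a' \<le> t" "t \<le> b'" for K' L' a' b' t
  proof -
    obtain K L a b where g: "gap K L a b" "{a'..b'} \<subseteq> F ` {a..b}"
      "(strict_mono F \<and> K = K' \<and> L = L') \<or> (strict_antimono_on UNIV F \<and> K = L' \<and> L = K')"
      using gap_pullback[OF f F(1) inv g'] by blast
    have "\<not> (strict_mono F \<and> strict_antimono_on UNIV F)"
      using strict_monoD[of F 0 1] monotone_onD[of UNIV "(<)" "(>)" F 0 1] by auto
    hence "(K, L) \<in> T" using g(3) T' F(2) by (metis symE)
    obtain s where s: "s \<in> {a..b}" "t = F s" using g(2) t by force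
    have "inv_into circle f (cis t) = inv_into circle f (f (cis s))" using F(1) s by (simp add: lift_def)
    also have "\<dots> = cis s" by (rule inv_into_f_f) (use circle_homeosD[OF f] in auto)
    finally show ?thesis using gap_unionI[OF g(1) \<open>(K, L) \<in> T\<close>] s by auto
  qed
  thus ?thesis by (auto elim!: gap_unionE)
qed

end

section \<open>Minimal sets\<close>

lemma invariant_setD:
  assumes "invariant_set \<F> K"
  shows "K \<noteq> {}" "K \<subseteq> circle" "f \<in> \<F> \<Longrightarrow> f ` K \<subseteq> K"
  using assms by (auto simp: invariant_set_def)

lemma minimal_setD:
  assumes "minimal_set \<F> K"
  shows "closed K" "invariant_set \<F> K" "K \<noteq> {}" "K \<subseteq> circle" "f \<in> \<F> \<Longrightarrow> f ` K \<subseteq> K"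
  using assms by (auto simp: minimal_set_def invariant_set_def)

lemma minimal_set_eq:
  assumes "minimal_set \<F> K" "closed L" "L \<subseteq> K" "L \<noteq> {}" "\<And>f. f \<in> \<F> \<Longrightarrow> f ` L \<subseteq> L"
  shows "L = K"
proof (rule ccontr)
  assume "L \<noteq> K"
  moreover have "invariant_set \<F> L"
    using assms minimal_setD(4)[OF assms(1)] by (auto simp: invariant_set_def)
  ultimately show False using assms unfolding minimal_set_def by blast
qed

lemma minimal_set_disjoint:
  assumes "minimal_set \<F> K" "minimal_set \<F> L" "z \<in> K" "z \<in> L"
  shows "K = L"
proof -
  have inv: "f ` (K \<inter> L) \<subseteq> K \<inter> L" if "f \<in> \<F>" for f
    using minimal_setD(5)[OF assms(1) that] minimal_setD(5)[OF assms(2) that] by blast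
  have cl: "closed (K \<inter> L)" using minimal_setD(1) assms by blast
  have "K \<inter> L = K" by (rule minimal_set_eq[OF assms(1) cl]) (use inv assms in auto)
  moreover have "K \<inter> L = L" by (rule minimal_set_eq[OF assms(2) cl]) (use inv assms in auto)
  ultimately show ?thesis by simp
qed

lemma minimal_set_exists:
  assumes "closed K" "invariant_set \<F> K"
  obtains L where "L \<subseteq> K" "minimal_set \<F> L"
proof -
  define \<A> where "\<A> = {L. closed L \<and> L \<subseteq> K \<and> invariant_set \<F> L}"
  \<comment> \<open>Complements turn the search for a minimal set into one for a maximal set; the
    bound for a chain is nonempty as an intersection of nested nonempty compact sets.\<close>
  have "\<exists>M\<in>uminus ` \<A>. \<forall>X\<in>uminus ` \<A>. M \<subseteq> X \<longrightarrow> X = M"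
  proof (rule subset_Zorn_nonempty)
    show "uminus ` \<A> \<noteq> {}" using assms by (auto simp: \<A>_def)
    fix \<C> assume C: "\<C> \<noteq> {}" "subset.chain (uminus ` \<A>) \<C>"
    define \<B> where "\<B> = uminus ` \<C>"
    have B: "\<B> \<noteq> {}" "\<B> \<subseteq> \<A>" using C by (auto simp: \<B>_def subset_chain_def image_subset_iff)
    have tot: "X \<subseteq> Y \<or> Y \<subseteq> X" if "X \<in> \<B>" "Y \<in> \<B>" for X Y
      using C that by (auto simp: \<B>_def subset_chain_def)
    have "compact X" if "X \<in> \<B>" for X
    proof -
      have "X \<in> \<A>" using that B by blast
      hence "closed X" "X \<subseteq> circle" using invariant_setD(2) unfolding \<A>_def by blast+
      thus ?thesis by (metis compact_Int_closed compact_sphere inf.absorb_iff2)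
    qed
    moreover have "{} \<notin> \<B>" using B by (auto simp: \<A>_def invariant_set_def)
    ultimately have "\<Inter>\<B> \<noteq> {}" using tot by (intro compact_chain) auto
    moreover have "closed (\<Inter>\<B>)" using B by (auto simp: \<A>_def)
    moreover have "\<Inter>\<B> \<subseteq> K" "\<Inter>\<B> \<subseteq> circle"
      using B unfolding \<A>_def invariant_set_def by blast+
    moreover have "f ` \<Inter>\<B> \<subseteq> \<Inter>\<B>" if "f \<in> \<F>" for f
      using B that by (fastforce simp: \<A>_def invariant_set_def)
    ultimately have "\<Inter>\<B> \<in> \<A>" by (auto simp: \<A>_def invariant_set_def)
    moreover have "\<Union>\<C> = - \<Inter>\<B>" by (auto simp: \<B>_def)
    ultimately show "\<Union>\<C> \<in> uminus ` \<A>" by blast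
  qed
  then obtain L where L: "L \<in> \<A>" "\<And>X. X \<in> \<A> \<Longrightarrow> X \<subseteq> L \<Longrightarrow> X = L" by auto
  have "minimal_set \<F> L"
    using L unfolding minimal_set_def \<A>_def by blast
  thus ?thesis using that L(1) by (auto simp: \<A>_def)
qed

lemma coloured_minimal_sets:
  assumes "finite KK" "KK \<subseteq> {K. minimal_set \<F> K}"
  shows "coloured KK"
proof
  show "\<And>K L z. K \<in> KK \<Longrightarrow> L \<in> KK \<Longrightarrow> z \<in> K \<Longrightarrow> z \<in> L \<Longrightarrow> K = L"
    using assms minimal_set_disjoint by blast
qed (use assms minimal_setD(1,4) in blast)+

subsection \<open>Minimal sets of the inverse family\<close>

lemma inverse_family_circle:
  assumes "\<F> \<subseteq> circle_homeos" "g \<in> inverse_family \<F>"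
  shows "g ` circle = circle"
  using assms circle_homeosD(1) by (force simp: inverse_family_def homeomorphism_def)

lemma inverse_family_minimal_exists:
  assumes "\<F> \<subseteq> circle_homeos"
  obtains L where "minimal_set (inverse_family \<F>) L"
proof (rule minimal_set_exists[of circle "inverse_family \<F>"])
  show "invariant_set (inverse_family \<F>) circle"
    using inverse_family_circle[OF assms] by (auto simp: invariant_set_def simp del: mem_sphere)
qed (use that in auto)

context
  fixes \<F> KK
  assumes homeos: "\<F> \<subseteq> circle_homeos"
    and no_finite: "\<And>K. finite K \<Longrightarrow> \<not> invariant_set (inverse_family \<F>) K"
    and KK: "finite KK" "KK \<subseteq> {K. minimal_set \<F> K}"
    and fin': "finite {K. minimal_set (inverse_family \<F>) K}"
begin

interpretation coloured KK by (rule coloured_minimal_sets) fact+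

text \<open>Distinct types of gaps yield distinct minimal sets of the inverse family, because the
  corresponding unions of closed gaps meet in a finite set.\<close>

lemma card_gap_types_le:
  assumes T: "\<And>i. i \<in> I \<Longrightarrow> sym (T i) \<or> \<F> \<subseteq> circle_homeos_pos"
    and gap: "\<And>i. i \<in> I \<Longrightarrow> \<exists>K L a b. gap K L a b \<and> (K, L) \<in> T i"
    and disj: "\<And>i j. i \<in> I \<Longrightarrow> j \<in> I \<Longrightarrow> i \<noteq> j \<Longrightarrow> T i \<inter> T j = {}"
  shows "card I \<le> card {K. minimal_set (inverse_family \<F>) K}"
proof -
  have "\<exists>L. minimal_set (inverse_family \<F>) L \<and> L \<subseteq> gap_union (T i)" if i: "i \<in> I" for i
  proof -
    obtain K L a b where g: "gap K L a b" "(K, L) \<in> T i" using gap[OF i] by blast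
    hence "cis a \<in> gap_union (T i)" by (intro gap_unionI[OF g]) (auto simp: gap_def)
    moreover have "g ` gap_union (T i) \<subseteq> gap_union (T i)" if g: "g \<in> inverse_family \<F>" for g
    proof -
      obtain f where f: "f \<in> \<F>" "g = inv_into circle f" using g by (auto simp: inverse_family_def)
      have "f ` K \<subseteq> K" if "K \<in> KK" for K using minimal_setD(5) f(1) that KK(2) by blast
      thus ?thesis unfolding f(2) using f(1) homeos T[OF i] by (intro gap_union_backward) auto
    qed
    ultimately have "invariant_set (inverse_family \<F>) (gap_union (T i))"
      using gap_union_circle by (auto simp: invariant_set_def)
    thus ?thesis using minimal_set_exists closed_gap_union by metis
  qed
  then obtain M where M: "\<And>i. i \<in> I \<Longrightarrow> minimal_set (inverse_family \<F>) (M i)"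
    "\<And>i. i \<in> I \<Longrightarrow> M i \<subseteq> gap_union (T i)" by metis
  have "inj_on M I"
  proof (rule inj_onI, rule ccontr)
    fix i j assume ij: "i \<in> I" "j \<in> I" "M i = M j" "i \<noteq> j"
    have "M i \<subseteq> gap_union (T i) \<inter> gap_union (T j)" using M(2) ij by (metis Int_subset_iff)
    hence "finite (M i)" using finite_gap_union_Int[OF disj] ij finite_subset by blast
    thus False using no_finite M(1) minimal_setD(2) ij by blast
  qed
  thus ?thesis using M(1) fin' by (intro card_inj_on_le) auto
qed

lemma circle_points:
  assumes "K \<in> KK"
  obtains t where "cis t \<in> K" "x \<le> t"
proof -
  obtain z where "z \<in> K" "z \<in> circle" using assms KK(2) minimal_setD(3,4) by blast
  thus ?thesis using circle_cis_from that by metis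
qed

text \<open>Gaps are sorted by their right colour: with two or more colours each one is entered by
  some gap, and pairs with different right colours are different. With at most one colour there is
  no gap, and the existence of one minimal set of the inverse family suffices.\<close>

lemma card_minimal_le_pos:
  assumes "\<F> \<subseteq> circle_homeos_pos"
  shows "card KK \<le> card {K. minimal_set (inverse_family \<F>) K}"
proof (cases "card KK \<le> 1")
  case True
  obtain L where "minimal_set (inverse_family \<F>) L" by (rule inverse_family_minimal_exists[OF homeos])
  hence "card {K. minimal_set (inverse_family \<F>) K} > 0" using fin' by (auto simp: card_gt_0_iff)
  thus ?thesis using True by linarith
next
  case False
  show ?thesis
  proof (rule card_gap_types_le[of KK "\<lambda>L. {(K, L) | K. K \<in> KK}"])
    fix L assume L: "L \<in> KK"
    have "KK \<noteq> {L}" using False by auto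
    then obtain K where K: "K \<in> KK" "K \<noteq> L" using L by blast
    obtain x where x: "cis x \<in> K" using circle_points K by blast
    obtain y where y: "cis y \<in> L" "x \<le> y" using circle_points L by blast
    have "x \<noteq> y" using K L x y disjoint_KK by blast
    with y(2) have "x < y" by simp
    obtain K' a b where "gap K' L a b" by (rule gap_before[OF K(1) L K(2) x y(1) \<open>x < y\<close>])
    moreover from this have "K' \<in> KK" by (simp add: gap_def)
    ultimately show "\<exists>K L' a b. gap K L' a b \<and> (K, L') \<in> {(K, L) | K. K \<in> KK}" by blast
  qed (use assms in auto)
qed

text \<open>Starting from a point of colour \<open>C\<close>, each other colour is entered for the first time
  through a gap; the types of these gaps form a tree, so there are at least \<open>card KK - 1\<close> types.\<close>

lemma card_minimal_le:
  "card KK \<le> card {K. minimal_set (inverse_family \<F>) K} + 1"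
proof (cases "KK = {}")
  case False
  then obtain C where C: "C \<in> KK" by blast
  obtain x where x: "cis x \<in> C" using circle_points C by blast
  have "\<exists>K a b. gap K L a b \<and> x \<le> a \<and> (\<forall>t. x \<le> t \<longrightarrow> t < b \<longrightarrow> cis t \<notin> L)" if L: "L \<in> KK - {C}" for L
  proof -
    obtain y where y: "cis y \<in> L" "x \<le> y" using circle_points L by blast
    have "x \<noteq> y" using C L x y disjoint_KK by blast
    thus ?thesis using gap_before[of C L x y] C L x y by (metis DiffD1 DiffD2 insertI1 order_le_less)
  qed
  then obtain p a b where p: "\<And>L. L \<in> KK - {C} \<Longrightarrow> gap (p L) L (a L) (b L)"
    "\<And>L. L \<in> KK - {C} \<Longrightarrow> x \<le> a L"
    "\<And>L t. L \<in> KK - {C} \<Longrightarrow> x \<le> t \<Longrightarrow> t < b L \<Longrightarrow> cis t \<notin> L" by metis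
  have "card (KK - {C}) \<le> card {K. minimal_set (inverse_family \<F>) K}"
  proof (rule card_gap_types_le[of _ "\<lambda>L. {(p L, L), (L, p L)}"])
    fix L L' assume L: "L \<in> KK - {C}" "L' \<in> KK - {C}" "L \<noteq> L'"
    show "{(p L, L), (L, p L)} \<inter> {(p L', L'), (L', p L')} = {}"
    proof (rule ccontr)
      assume "{(p L, L), (L, p L)} \<inter> {(p L', L'), (L', p L')} \<noteq> {}"
      \<comment> \<open>Then \<open>L'\<close> is present where the first gap into \<open>L\<close>
        starts, and conversely, so each colour would be entered strictly before the other.\<close>
      hence "p L = L'" "p L' = L" using L(3) by auto
      hence "cis (a L) \<in> L'" "cis (a L') \<in> L" "a L < b L" "a L' < b L'"
        using p(1)[OF L(1)] p(1)[OF L(2)] by (simp_all add: gap_def)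
      thus False
        using p(3)[OF L(2) p(2)[OF L(1)]] p(3)[OF L(1) p(2)[OF L(2)]] by fastforce
    qed
  next
    show "\<exists>K L' a b. gap K L' a b \<and> (K, L') \<in> {(p L, L), (L, p L)}" if "L \<in> KK - {C}" for L
      using p(1)[OF that] by blast
  qed (auto simp: sym_def)
  thus ?thesis using C KK(1) by (simp add: card_Diff_singleton)
qed simp

end

section \<open>Finiteness for orientation-preserving families\<close>

text \<open>\<open>cis\<close> need not map closed sets to closed sets; by periodicity the compact
  part of \<open>S\<close> in one period has the same image as \<open>S\<close>.\<close>

lemma closed_cis_image:
  assumes "closed S" "\<And>t n. t \<in> S \<Longrightarrow> t + 2 * pi * of_int n \<in> S"
  shows "closed (cis ` S)"
proof -
  have "cis ` S = cis ` ({0..2 * pi} \<inter> S)"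
  proof (intro equalityI subsetI)
    fix z assume "z \<in> cis ` S"
    then obtain t where t: "t \<in> S" "z = cis t" by blast
    obtain s where s: "cis t = cis s" "0 \<le> s" "s < 0 + 2 * pi"
      using circle_cis_from[of "cis t" 0] by auto
    then obtain n :: int where "s = t + 2 * pi * n" using cis_eq_cis_iff by metis
    hence "s \<in> {0..2 * pi} \<inter> S" using assms(2) t(1) s by auto
    thus "z \<in> cis ` ({0..2 * pi} \<inter> S)" using s(1) t(2) by auto
  qed auto
  moreover have "compact ({0..2 * pi} \<inter> S)" using assms(1) by (intro compact_Int_closed) auto
  hence "compact (cis ` ({0..2 * pi} \<inter> S))"
    by (intro compact_continuous_image continuous_intros)
  ultimately show ?thesis using compact_imp_closed by simp
qed

text \<open>Looking backwards from \<open>t\<close>, the set \<open>B\<close> is met before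
  \<open>C\<close>. This reads off the cyclic order of three disjoint sets at a single point of the
  third.\<close>

definition preceded :: "complex set \<Rightarrow> complex set \<Rightarrow> real \<Rightarrow> bool" where
  "preceded B C t \<longleftrightarrow> (\<exists>u\<le>t. cis u \<in> B \<and> (\<forall>s. u \<le> s \<longrightarrow> s \<le> t \<longrightarrow> cis s \<notin> C))"

lemma preceded_shift: "preceded B C t \<Longrightarrow> preceded B C (t + 2 * pi * of_int n)"
  unfolding preceded_def
proof (elim exE conjE)
  fix u assume u: "u \<le> t" "cis u \<in> B" "\<forall>s. u \<le> s \<longrightarrow> s \<le> t \<longrightarrow> cis s \<notin> C"
  have "cis s \<notin> C" if "u + 2 * pi * of_int n \<le> s" "s \<le> t + 2 * pi * of_int n" for s
    using u(3)[rule_format, of "s + 2 * pi * of_int (- n)"] that unfolding cis_shift by auto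
  thus "\<exists>u\<le>t + 2 * pi * of_int n. cis u \<in> B \<and> (\<forall>s. u \<le> s \<longrightarrow> s \<le> t + 2 * pi * of_int n \<longrightarrow> cis s \<notin> C)"
    using u by (intro exI[of _ "u + 2 * pi * of_int n"]) auto
qed

lemma preceded_cis_cong:
  assumes "preceded B C t" "cis t = cis t'" shows "preceded B C t'"
proof -
  obtain n :: int where "t' = t + 2 * pi * n" using assms(2) cis_eq_cis_iff by metis
  thus ?thesis using preceded_shift[OF assms(1)] by simp
qed

lemma minimal_set_point_below:
  assumes "minimal_set \<F> K" obtains t where "cis t \<in> K" "t \<le> x"
proof -
  obtain z where "z \<in> K" "z \<in> circle" using assms minimal_setD(3,4) by blast
  then obtain t where "z = cis t" "x - 2 * pi \<le> t" "t < x - 2 * pi + 2 * pi" using circle_cis_from by metis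
  thus ?thesis using that[of t] \<open>z \<in> K\<close> by auto
qed

context
  fixes \<F>
  assumes pos: "\<F> \<subseteq> circle_homeos_pos"
begin

text \<open>Otherwise the last point \<open>w\<close> of \<open>B \<union> C\<close> up to
  \<open>F t\<close> is in \<open>C\<close> and starts a gap from \<open>C\<close> to
  \<open>A\<close>, which is covered by the image of a gap from \<open>C\<close> to
  \<open>A\<close>. As no \<open>C\<close> lies between \<open>u0\<close> and \<open>t\<close>, the
  latter gap starts before \<open>u0\<close>; as \<open>u0\<close> has colour \<open>B\<close>, it
  also ends no later than \<open>u0\<close>. This puts \<open>w\<close> before \<open>F u0\<close>,
  against its choice.\<close>

lemma preceded_forward:
  assumes ABC: "minimal_set \<F> A" "minimal_set \<F> B" "minimal_set \<F> C" "A \<noteq> B" "A \<noteq> C" "B \<noteq> C"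
    and f: "f \<in> \<F>" and F: "f \<in> circle_homeos" "lift f F" "strict_mono F"
    and t: "cis t \<in> A" "preceded B C t"
  shows "preceded B C (F t)"
proof -
  interpret coloured "{A, B, C}" by (rule coloured_minimal_sets) (use ABC in auto)
  have inv: "f ` K \<subseteq> K" if "K \<in> {A, B, C}" for K using that ABC minimal_setD(5) f by blast
  have cisF: "cis (F s) \<in> K" if "cis s \<in> K" "K \<in> {A, B, C}" for s K
    using inv[OF that(2)] that(1) F(2) by (force simp: lift_def)
  obtain u0 where u0: "u0 \<le> t" "cis u0 \<in> B" "\<And>s. u0 \<le> s \<Longrightarrow> s \<le> t \<Longrightarrow> cis s \<notin> C"
    using t(2) by (auto simp: preceded_def)
  have "closed (cis -` (B \<union> C))" using ABC minimal_setD(1) closed_vimage_cis by (metis closed_Un)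
  moreover have "F u0 \<le> F t" using F(3) u0(1) by (simp add: strict_mono_less_eq)
  moreover have "cis (F u0) \<in> B" using cisF u0(2) by blast
  ultimately obtain w where w: "cis w \<in> B \<union> C" "F u0 \<le> w" "w \<le> F t"
    "\<And>s. cis s \<in> B \<union> C \<Longrightarrow> s \<le> F t \<Longrightarrow> s \<le> w"
    using closed_last_point[of "cis -` (B \<union> C)" "F u0" "F t"] by auto
  show ?thesis
  proof (cases "cis w \<in> C")
    case False
    hence "cis s \<notin> C" if "w \<le> s" "s \<le> F t" for s using that w(4)[of s] by force
    thus ?thesis using False w unfolding preceded_def by blast
  next
    case True
    have FA: "cis (F t) \<in> A" using cisF t(1) by blast
    hence "w \<noteq> F t" using True disjoint_KK ABC by blast
    then obtain L a b where g: "gap C L a b" "w \<le> a" "b \<le> F t"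
      using gap_after[of C A w "F t"] True FA w(3) ABC by force
    have "a = w" using g w(4)[of a] by (auto simp: gap_def)
    have "a < b" "cis b \<in> L" "L \<in> {A, B, C}" using g(1) by (auto simp: gap_def)
    hence "cis b \<notin> B \<union> C" using w(4)[of b] g(3) \<open>a = w\<close> by force
    hence "L = A" using \<open>cis b \<in> L\<close> \<open>L \<in> {A, B, C}\<close> by blast
    obtain a0 b0 where g0: "gap C A a0 b0" "{a..b} \<subseteq> F ` {a0..b0}"
    proof (rule gap_pullback[OF F(1,2) inv g(1)[unfolded \<open>L = A\<close>]])
      fix K M a0 b0 assume *: "gap K M a0 b0" "{a..b} \<subseteq> F ` {a0..b0}"
        "strict_mono F \<and> K = C \<and> M = A \<or> strict_antimono_on UNIV F \<and> K = A \<and> M = C"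
      have "\<not> strict_antimono_on UNIV F"
        using strict_monoD[OF F(3), of 0 1] monotone_onD[of UNIV "(<)" "(>)" F 0 1] by auto
      thus thesis using that * by blast
    qed
    have le: "F x \<le> F y \<longleftrightarrow> x \<le> y" for x y by (rule strict_mono_less_eq[OF F(3)])
    have "a \<in> F ` {a0..b0}" "b \<in> F ` {a0..b0}" using g0(2) \<open>a < b\<close> by auto
    hence ab: "F a0 \<le> a" "b \<le> F b0" using le by auto
    have "F a0 < F t" using ab g \<open>a < b\<close> by linarith
    hence "a0 \<le> t" using le by (meson less_imp_le)
    have "cis a0 \<in> C" "cis b0 \<in> A" using g0 by (auto simp: gap_def)
    hence "a0 < u0" using u0(3)[of a0] \<open>a0 \<le> t\<close> by force
    have "\<not> u0 < b0" using g0(1) \<open>a0 < u0\<close> u0(2) unfolding gap_def by blast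
    hence "F b0 \<le> F u0" using le by simp
    hence "F u0 > w" using ab \<open>a < b\<close> \<open>a = w\<close> by linarith
    thus ?thesis using w(2) by linarith
  qed
qed

text \<open>The points of \<open>A\<close> from which, looking backwards, \<open>B\<close> is met
  before \<open>C\<close> form a closed invariant subset of \<open>A\<close>, so minimality makes it
  all of \<open>A\<close>. It is closed because a small interval around a point over
  \<open>A\<close> contains neither \<open>B\<close> nor \<open>C\<close>.\<close>

lemma preceded_uniform:
  assumes ABC: "minimal_set \<F> A" "minimal_set \<F> B" "minimal_set \<F> C" "A \<noteq> B" "A \<noteq> C" "B \<noteq> C"
    and t: "cis t \<in> A" "preceded B C t" and t': "cis t' \<in> A"
  shows "preceded B C t'"
proof -
  define S where "S = {t. cis t \<in> A \<and> preceded B C t}"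
  have clBC: "closed (cis -` (B \<union> C))" using ABC minimal_setD(1) closed_vimage_cis by (metis closed_Un)
  have clA: "closed (cis -` A)" using ABC minimal_setD(1) closed_vimage_cis by metis
  have "open (- S)"
  proof (subst open_dist, intro ballI)
    fix t assume "t \<in> - S"
    show "\<exists>e>0. \<forall>s. dist s t < e \<longrightarrow> s \<in> - S"
    proof (cases "cis t \<in> A")
      case False
      have "open (- (cis -` A))" using clA by auto
      then obtain e where "e > 0" "\<And>s. dist s t < e \<Longrightarrow> cis s \<notin> A"
        using False unfolding open_dist by force
      thus ?thesis by (auto simp: S_def)
    next
      case True
      hence "t \<in> - (cis -` (B \<union> C))" using minimal_set_disjoint ABC by blast
      moreover have "open (- (cis -` (B \<union> C)))" using clBC by (rule open_Compl)
      ultimately obtain e where e: "e > 0" "\<And>s. dist s t < e \<Longrightarrow> cis s \<notin> B \<union> C"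
        unfolding open_dist by force
      have "\<not> preceded B C s" if s: "dist s t < e" for s
      proof
        assume "preceded B C s"
        then obtain u where u: "u \<le> s" "cis u \<in> B" "\<And>r. u \<le> r \<Longrightarrow> r \<le> s \<Longrightarrow> cis r \<notin> C"
          by (auto simp: preceded_def)
        have "\<not> dist u t < e" using e(2)[of u] u(2) by blast
        hence "u \<le> t" using u(1) s by (auto simp: dist_real_def)
        moreover have "cis r \<notin> C" if "u \<le> r" "r \<le> t" for r
          using u(3)[of r] e(2)[of r] that s by (cases "r \<le> s") (auto simp: dist_real_def)
        ultimately have "preceded B C t" using u(2) unfolding preceded_def by blast
        thus False using \<open>t \<in> - S\<close> True by (simp add: S_def)
      qed
      thus ?thesis using e(1) by (auto simp: S_def)
    qed
  qed
  hence "closed S" by (simp add: closed_def)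
  moreover have "t + 2 * pi * of_int n \<in> S" if "t \<in> S" for t n using that preceded_shift by (auto simp: S_def)
  ultimately have "closed (cis ` S)" by (rule closed_cis_image)
  moreover have "cis ` S \<subseteq> A" by (auto simp: S_def)
  moreover have "cis ` S \<noteq> {}" using t by (auto simp: S_def)
  moreover have "f ` cis ` S \<subseteq> cis ` S" if f: "f \<in> \<F>" for f
  proof -
    obtain F where F: "f \<in> circle_homeos" "lift f F" "strict_mono F"
      using circle_homeos_pos_lift pos f by blast
    have "F t \<in> S" if "t \<in> S" for t
    proof -
      have "f ` A \<subseteq> A" using minimal_setD(5) ABC(1) f by blast
      moreover have "f (cis t) = cis (F t)" using F(2) by (simp add: lift_def)
      ultimately show ?thesis using preceded_forward[OF ABC f F] that by (auto simp: S_def)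
    qed
    thus ?thesis using F(2) by (auto simp: lift_def)
  qed
  ultimately have "cis ` S = A" using minimal_set_eq[OF ABC(1)] by metis
  then obtain s where "s \<in> S" "cis t' = cis s" using t' by (metis imageE)
  thus ?thesis using preceded_cis_cong[of B C s t'] by (simp add: S_def)
qed

text \<open>In other words, the three sets follow each other in a fixed cyclic order around the circle.\<close>

lemma minimal_sets_interlaced:
  assumes ABC: "minimal_set \<F> A" "minimal_set \<F> B" "minimal_set \<F> C" "A \<noteq> B" "A \<noteq> C" "B \<noteq> C"
    and xy: "cis x \<in> A" "cis y \<in> A" "cis z \<in> C" "x < z" "z < y"
  shows "\<exists>s. cis s \<in> B \<and> x < s \<and> s < y"
proof (rule ccontr)
  assume "\<not> ?thesis"
  hence "cis s \<notin> B" if "x < s" "s < y" for s using that by blast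
  moreover have "cis x \<notin> B" "cis y \<notin> B" using xy ABC minimal_set_disjoint by metis+
  ultimately have noB: "cis s \<notin> B" if "x \<le> s" "s \<le> y" for s using that by (metis order_le_less)
  have clB: "closed (cis -` B)" and clAC: "closed (cis -` (A \<union> C))"
    using ABC minimal_setD(1) closed_vimage_cis closed_Un by metis+
  obtain w0 where w0: "cis w0 \<in> B" "w0 \<le> x" using minimal_set_point_below ABC(2) by metis
  obtain w where w: "cis w \<in> B" "w \<le> x" "\<And>t. cis t \<in> B \<Longrightarrow> t \<le> x \<Longrightarrow> t \<le> w"
    using closed_last_point[OF clB, of w0 x] w0 by auto
  obtain p where p: "cis p \<in> A \<union> C" "p \<le> x" "w \<le> p" "\<And>t. cis t \<in> A \<union> C \<Longrightarrow> w \<le> t \<Longrightarrow> p \<le> t"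
    using closed_first_point[OF clAC, of x w] xy w(2) by auto
  have noB': "cis s \<notin> B" if "w < s" "s \<le> y" for s
    using noB[of s] w(3)[of s] that by force
  \<comment> \<open>Looking backwards, \<open>C\<close> is met before \<open>B\<close> from
    \<open>y\<close>, because of \<open>z\<close>, and \<open>A\<close> before \<open>B\<close> from
    \<open>z\<close>, because of \<open>x\<close>. Uniformity spreads both facts to all of
    \<open>A\<close> and \<open>C\<close>.\<close>
  have A: "preceded C B t" if "cis t \<in> A" for t
  proof -
    have "preceded C B y" unfolding preceded_def
      using xy noB by (intro exI[of _ z]) auto
    thus ?thesis by (rule preceded_uniform[of A C B y, rotated 7]) (use ABC xy that in auto)
  qed
  have C: "preceded A B t" if "cis t \<in> C" for t
  proof -
    have "preceded A B z" unfolding preceded_def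
      using xy noB by (intro exI[of _ x]) auto
    thus ?thesis by (rule preceded_uniform[of C A B z, rotated 7]) (use ABC xy that in auto)
  qed
  have "w \<noteq> p" using w(1) p(1) ABC minimal_set_disjoint by (metis UnE)
  \<comment> \<open>At \<open>p\<close> neither fact can hold: nothing of
    \<open>A \<union> C\<close> lies between \<open>p\<close> and the point \<open>w\<close> of
    \<open>B\<close> behind it.\<close>
  from p(1) have "preceded C B p \<and> cis p \<in> A \<or> preceded A B p \<and> cis p \<in> C" using A C by blast
  then obtain u where u: "u \<le> p" "cis u \<in> A \<union> C" "u \<noteq> p" "\<forall>s. u \<le> s \<longrightarrow> s \<le> p \<longrightarrow> cis s \<notin> B"
    unfolding preceded_def using ABC minimal_set_disjoint by (metis UnCI)
  have "\<not> w \<le> u" using p(4)[OF u(2)] u(1,3) by auto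
  thus False using u(4) w(1) p(3) by auto
qed

end

section \<open>Limits of infinitely many minimal sets\<close>

lemma simultaneous_subsequence:
  fixes u :: "'a \<Rightarrow> nat \<Rightarrow> 'b::heine_borel"
  assumes "finite A" "\<And>k. k \<in> A \<Longrightarrow> bounded (range (u k))"
  shows "\<exists>r l. strict_mono r \<and> (\<forall>k\<in>A. (\<lambda>n. u k (r n)) \<longlonglongrightarrow> l k)"
  using assms
proof (induction A)
  case empty
  show ?case by (intro exI[of _ id]) (auto simp: strict_mono_def)
next
  case (insert k A)
  obtain r l where r: "strict_mono r" "\<And>j. j \<in> A \<Longrightarrow> (\<lambda>n. u j (r n)) \<longlonglongrightarrow> l j"
    using insert by auto
  have "bounded (range (u k \<circ> r))"
    using insert.prems[of k] by (rule bounded_subset) auto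
  then obtain c q where q: "strict_mono q" "((u k \<circ> r) \<circ> q) \<longlonglongrightarrow> c"
    using bounded_imp_convergent_subsequence by blast
  have "(\<lambda>n. u j (r (q n))) \<longlonglongrightarrow> (l(k := c)) j" if "j \<in> insert k A" for j
    using LIMSEQ_subseq_LIMSEQ[OF r(2) q(1), of j] q(2) that by (auto simp: o_def)
  thus ?case using strict_mono_o[OF r(1) q(1)] 
    by (intro exI[of _ "\<lambda>n. r (q n)"] exI[of _ "l(k := c)"]) (auto simp: o_def)
qed

lemma minimal_set_point_above:
  assumes "minimal_set \<F> K" obtains t where "cis t \<in> K" "x \<le> t"
proof -
  obtain z where "z \<in> K" "z \<in> circle" using assms minimal_setD(3,4) by blast
  thus ?thesis using circle_cis_from that by metis
qed

text \<open>Given infinitely many minimal sets besides \<open>M\<close>, finitely many gaps of \<open>M\<close> contain all of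
  them. Inside such a gap the hulls of the different minimal sets are disjoint, so their lengths
  tend to zero, and along a subsequence the minimal sets converge to a finite invariant set.\<close>

lemma finite_minimal_sets_pos:
  assumes pos: "\<F> \<subseteq> circle_homeos_pos"
    and no_finite: "\<And>K. finite K \<Longrightarrow> \<not> invariant_set \<F> K"
  shows "finite {K. minimal_set \<F> K}"
proof (rule ccontr)
  assume inf: "infinite {K. minimal_set \<F> K}"
  then obtain M where M: "minimal_set \<F> M" by (metis finite.emptyI empty_Collect_eq)
  obtain K :: "nat \<Rightarrow> complex set" where "inj K" "range K \<subseteq> {K. minimal_set \<F> K} - {M}"
    using infinite_countable_subset[of "{K. minimal_set \<F> K} - {M}"] inf by auto
  hence K: "\<And>n. minimal_set \<F> (K n)" "\<And>n. K n \<noteq> M" "\<And>m n. m \<noteq> n \<Longrightarrow> K m \<noteq> K n"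
    by (auto simp: inj_eq)
  have disj: "m = n" if "z \<in> K m" "z \<in> K n" for m n z
    using minimal_set_disjoint[OF K(1) K(1) that] K(3) by blast
  have disjM: "z \<notin> M" if "z \<in> K n" for n z
    using minimal_set_disjoint[OF K(1) M that] K(2) by blast
  note interlaced = minimal_sets_interlaced[OF pos]
  have clM: "closed (cis -` M)" and clK: "\<And>n. closed (cis -` K n)"
    using minimal_setD(1) M K(1) closed_vimage_cis by blast+
  \<comment> \<open>\<open>J\<close> collects the components of the complement of \<open>M\<close>
    that meet \<open>K 0\<close>, with left end in one period. By interlacing, every
    \<open>K n\<close> meets each of them (\<open>hit\<close>) and is contained in their union
    (\<open>cover\<close>).\<close>
  define J where "J = {(a, b). 0 \<le> a \<and> a < 2 * pi \<and> a < b \<and> cis a \<in> M \<and> cis b \<in> M \<and>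
    (\<forall>t. a < t \<longrightarrow> t < b \<longrightarrow> cis t \<notin> M) \<and> (\<exists>s. a < s \<and> s < b \<and> cis s \<in> K 0)}"
  have finJ: "finite J"
  proof -
    interpret coloured "{M, K 0}" by (rule coloured_minimal_sets[of _ \<F>]) (use M K in auto)
    have "inj_on fst J"
    proof (rule inj_onI)
      fix j j' assume "j \<in> J" "j' \<in> J" "fst j = fst j'"
      moreover from this obtain a b b' where "j = (a, b)" "j' = (a, b')" by (metis prod.collapse)
      ultimately show "j = j'" unfolding J_def by (cases b b' rule: linorder_cases) auto
    qed
    \<comment> \<open>In the colouring by \<open>M\<close> and \<open>K 0\<close> each such
      component begins with a gap, and gaps are finite in number.\<close>
    have "fst ` J \<subseteq> fst ` gaps"
    proof clarify
      fix a b assume "(a, b) \<in> J"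
      then obtain s where s: "0 \<le> a" "a < 2 * pi" "a < b" "cis a \<in> M"
        "\<forall>t. a < t \<longrightarrow> t < b \<longrightarrow> cis t \<notin> M" "a < s" "s < b" "cis s \<in> K 0"
        by (auto simp: J_def)
      obtain L c d where g: "gap M L c d" "a \<le> c" "d \<le> s"
        using gap_after[of M "K 0" a s] s K(2)[of 0] by force
      hence "cis c \<in> M" "c < d" by (auto simp: gap_def)
      hence "c = a" using s(5)[rule_format, of c] s(7) g(2,3) by fastforce
      hence "(a, d) \<in> gaps" using g s by (auto simp: gaps_def)
      thus "fst (a, b) \<in> fst ` gaps" by force
    qed
    thus ?thesis using \<open>inj_on fst J\<close> finite_gaps by (meson finite_imageD finite_imageI finite_subset)
  qed
  have hit: "\<exists>s. a < s \<and> s < b \<and> cis s \<in> K n" if ab: "(a, b) \<in> J" for a b n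
  proof -
    obtain s where s: "a < s" "s < b" "cis s \<in> K 0" "cis a \<in> M" "cis b \<in> M" using ab by (auto simp: J_def)
    show ?thesis
    proof (cases "n = 0")
      case False
      thus ?thesis using interlaced[OF M K(1) K(1), of n 0 a b s] s K(2,3) by metis
    qed (use s in auto)
  qed
  have cover: "\<exists>a b t. (a, b) \<in> J \<and> a < t \<and> t < b \<and> z = cis t" if z: "z \<in> K n" for z n
  proof -
    obtain t where t: "z = cis t" using z K(1) minimal_setD(4) circle_cis by blast
    obtain a0 where "cis a0 \<in> M" "a0 \<le> t" using minimal_set_point_below[OF M] by blast
    then obtain a where a: "cis a \<in> M" "a \<le> t" "\<And>s. cis s \<in> M \<Longrightarrow> s \<le> t \<Longrightarrow> s \<le> a"
      using closed_last_point[OF clM, of a0 t] by auto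
    obtain b0 where "cis b0 \<in> M" "t \<le> b0" using minimal_set_point_above[OF M] by blast
    then obtain b where b: "cis b \<in> M" "t \<le> b" "\<And>s. cis s \<in> M \<Longrightarrow> t \<le> s \<Longrightarrow> b \<le> s"
      using closed_first_point[OF clM, of b0 t] by auto
    have "cis t \<notin> M" using disjM z t by blast
    hence atb: "a < t" "t < b" using a(1,2) b(1,2) by (auto simp: order_le_less)
    have free: "cis s \<notin> M" if "a < s" "s < b" for s
      using a(3)[of s] b(3)[of s] that by linarith
    have "\<exists>s. cis s \<in> K 0 \<and> a < s \<and> s < b"
    proof (cases "n = 0")
      case False
      thus ?thesis using interlaced[OF M K(1) K(1), of 0 n a b t] a(1) b(1) atb z t K(2,3) by metis
    qed (use atb z t in auto)
    then obtain s where s: "cis s \<in> K 0" "a < s" "s < b" by blast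
    obtain a' where a': "cis a = cis a'" "0 \<le> a'" "a' < 0 + 2 * pi"
      using circle_cis_from[of "cis a" 0] by auto
    then obtain k :: int where k: "a' = a + 2 * pi * k" using cis_eq_cis_iff by metis
    have "cis r \<notin> M" if "a' < r" "r < b + 2 * pi * k" for r
      using free[of "r + 2 * pi * of_int (- k)"] that unfolding cis_shift k by auto
    hence "(a', b + 2 * pi * k) \<in> J"
      using a' a b s atb unfolding J_def by (auto intro!: exI[of _ "s + 2 * pi * k"] simp: k)
    thus ?thesis using atb t by (intro exI[of _ a'] exI[of _ "b + 2 * pi * k"] exI[of _ "t + 2 * pi * k"]) (auto simp: k)
  qed
  have "\<exists>h g. fst j < h \<and> h \<le> g \<and> g < snd j \<and> cis h \<in> K n \<and> cis g \<in> K n \<and>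
      (\<forall>t. fst j < t \<longrightarrow> t < snd j \<longrightarrow> cis t \<in> K n \<longrightarrow> h \<le> t \<and> t \<le> g)" if j: "j \<in> J" for j n
  proof -
    obtain a b where ab: "j = (a, b)" "cis a \<in> M" "cis b \<in> M" using j by (auto simp: J_def)
    obtain s where s: "a < s" "s < b" "cis s \<in> K n" using hit j ab(1) by blast
    obtain h where h: "cis h \<in> K n" "h \<le> s" "a \<le> h" "\<And>t. cis t \<in> K n \<Longrightarrow> a \<le> t \<Longrightarrow> h \<le> t"
      using closed_first_point[OF clK, of s n a] s by auto
    obtain g where g: "cis g \<in> K n" "s \<le> g" "g \<le> b" "\<And>t. cis t \<in> K n \<Longrightarrow> t \<le> b \<Longrightarrow> t \<le> g"
      using closed_last_point[OF clK, of s n b] s by auto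
    have "h \<noteq> a" "g \<noteq> b" using disjM h(1) g(1) ab by auto
    thus ?thesis using h g ab(1) by (intro exI[of _ h] exI[of _ g]) auto
  qed
  then obtain H G where HG: "\<And>j n. j \<in> J \<Longrightarrow> fst j < H j n \<and> H j n \<le> G j n \<and> G j n < snd j"
    "\<And>j n. j \<in> J \<Longrightarrow> cis (H j n) \<in> K n" "\<And>j n. j \<in> J \<Longrightarrow> cis (G j n) \<in> K n"
    "\<And>j n t. j \<in> J \<Longrightarrow> fst j < t \<Longrightarrow> t < snd j \<Longrightarrow> cis t \<in> K n \<Longrightarrow> H j n \<le> t \<and> t \<le> G j n"
    by metis
  have not_between: "\<not> (H j n < H j m \<and> H j m < G j n)" if j: "j \<in> J" and nm: "n \<noteq> m" for j n m
  proof
    assume "H j n < H j m \<and> H j m < G j n"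
    \<comment> \<open>Between the two points of \<open>K n\<close> lies a point of
      \<open>K m\<close>, so interlacing puts a point of \<open>M\<close> there, inside a component
      of its complement.\<close>
    then obtain s where s: "cis s \<in> M" "H j n < s" "s < G j n"
      using interlaced[OF K(1) M K(1), of n m "H j n" "G j n" "H j m"] HG(2,3)[OF j] K(2,3) nm by metis
    hence "fst j < s" "s < snd j" using HG(1)[OF j, of n] by linarith+
    thus False using j s(1) by (auto simp: J_def)
  qed
  have hulls: "n = m" if j: "j \<in> J" and x: "H j n < x" "x < G j n" "H j m < x" "x < G j m" for j n m x
  proof (rule ccontr)
    assume nm: "n \<noteq> m"
    have "H j n \<noteq> H j m" using HG(2)[OF j] disj nm by metis
    thus False using not_between[OF j nm] not_between[OF j nm[symmetric]] x by linarith
  qed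
  have "bounded (range (\<lambda>n. (H j n, G j n)))" if j: "j \<in> J" for j
  proof (rule bounded_subset)
    show "bounded ({fst j..snd j} \<times> {fst j..snd j})" by (intro bounded_Times) auto
    show "range (\<lambda>n. (H j n, G j n)) \<subseteq> {fst j..snd j} \<times> {fst j..snd j}"
    proof clarify
      fix n show "H j n \<in> {fst j..snd j} \<and> G j n \<in> {fst j..snd j}" using HG(1)[OF j, of n] by auto
    qed
  qed
  then obtain r l where r: "strict_mono r"
    and l: "\<And>j. j \<in> J \<Longrightarrow> (\<lambda>n. (H j (r n), G j (r n))) \<longlonglongrightarrow> l j"
    using simultaneous_subsequence[OF finJ, of "\<lambda>j n. (H j n, G j n)"] by blast
  define p where "p j = fst (l j)" for j
  have limH: "(\<lambda>n. H j (r n)) \<longlonglongrightarrow> p j" if "j \<in> J" for j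
    using tendsto_fst[OF l[OF that]] by (simp add: p_def)
  have limG: "(\<lambda>n. G j (r n)) \<longlonglongrightarrow> p j" if j: "j \<in> J" for j
  proof -
    define q where "q = snd (l j)"
    have q: "(\<lambda>n. G j (r n)) \<longlonglongrightarrow> q"
      using tendsto_snd[OF l[OF j]] by (simp add: q_def)
    have "p j \<le> q" by (rule LIMSEQ_le[OF limH[OF j] q]) (use HG(1)[OF j] in auto)
    moreover have "\<not> p j < q"
    proof
      assume "p j < q"
      \<comment> \<open>From some index on, this midpoint would lie inside all hulls, although hulls
        of different minimal sets do not overlap.\<close>
      define x where "x = (p j + q) / 2"
      have "p j < x" "x < q" using \<open>p j < q\<close> by (auto simp: x_def)
      hence "eventually (\<lambda>n. H j (r n) < x \<and> x < G j (r n)) sequentially"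
        using order_tendstoD[OF limH[OF j]] order_tendstoD[OF q] by (intro eventually_conj) auto
      then obtain N where "\<And>n. n \<ge> N \<Longrightarrow> H j (r n) < x \<and> x < G j (r n)"
        by (auto simp: eventually_sequentially)
      hence "r N = r (Suc N)" by (intro hulls[OF j]) auto
      thus False using r by (simp add: strict_mono_eq)
    qed
    ultimately show ?thesis using q by simp
  qed
  define P where "P = cis ` p ` J"
  have finP: "finite P" using finJ by (simp add: P_def)
  have "J \<noteq> {}" using cover[of _ 0] minimal_setD(3)[OF K(1)[of 0]] by blast
  have "f ` P \<subseteq> P" if f: "f \<in> \<F>" for f
  proof
    fix y assume "y \<in> f ` P"
    then obtain j where j: "j \<in> J" "y = f (cis (p j))" by (auto simp: P_def)
    have "f \<in> circle_homeos" using f pos by (auto simp: circle_homeos_pos_def)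
    hence contf: "continuous_on circle f" by (rule circle_homeosD(3))
    have "(\<lambda>n. cis (H j (r n))) \<longlonglongrightarrow> cis (p j)"
      by (intro tendsto_intros limH j)
    hence lim: "(\<lambda>n. f (cis (H j (r n)))) \<longlonglongrightarrow> y"
      unfolding j(2) by (intro continuous_on_tendsto_compose[OF contf]) auto
    show "y \<in> P"
    proof (rule ccontr)
      assume "y \<notin> P"
      then obtain e where e: "e > 0" "\<And>x. x \<in> P \<Longrightarrow> e \<le> dist y x"
        using finP separate_point_closed[of P y] finite_imp_closed by blast
      \<comment> \<open>The image of \<open>cis (H j (r n))\<close> is in \<open>K (r n)\<close>,
        hence in one of its hulls, both ends of which are within \<open>e / 2\<close> of the limit
        \<open>p i\<close>; the other \<open>e / 2\<close> is spent on the distance to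
        \<open>y\<close>.\<close>
      have "eventually (\<lambda>n. \<forall>i\<in>J. dist (H i (r n)) (p i) < e / 2 \<and> dist (G i (r n)) (p i) < e / 2) sequentially"
        using finJ e(1) by (intro eventually_ball_finite ballI eventually_conj tendstoD limH limG) auto
      moreover have "eventually (\<lambda>n. dist (f (cis (H j (r n)))) y < e / 2) sequentially"
        using e(1) by (intro tendstoD[OF lim]) auto
      ultimately obtain n where n: "\<And>i. i \<in> J \<Longrightarrow> dist (H i (r n)) (p i) < e / 2 \<and> dist (G i (r n)) (p i) < e / 2"
        "dist (f (cis (H j (r n)))) y < e / 2"
        using eventually_happens'[OF sequentially_bot eventually_conj] by blast
      have "f (cis (H j (r n))) \<in> K (r n)"
        using HG(2)[OF j(1)] minimal_setD(5)[OF K(1) f] by blast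
      then obtain a b t where t: "(a, b) \<in> J" "a < t" "t < b" "f (cis (H j (r n))) = cis t"
        using cover by blast
      hence "H (a, b) (r n) \<le> t" "t \<le> G (a, b) (r n)"
        using HG(4)[of "(a, b)" t "r n"] \<open>f (cis (H j (r n))) \<in> K (r n)\<close> by auto
      hence "\<bar>t - p (a, b)\<bar> < e / 2" using n(1)[OF t(1)] unfolding dist_real_def by linarith
      hence "dist (cis t) (cis (p (a, b))) < e / 2"
        using norm_cis_diff_le[of t "p (a, b)"] by (simp add: dist_norm)
      hence "dist y (cis (p (a, b))) < e" using n(2) t(4) by (metis dist_commute dist_triangle_half_r)
      thus False using e(2)[of "cis (p (a, b))"] t(1) by (auto simp: P_def)
    qed
  qed
  hence "invariant_set \<F> P" using \<open>J \<noteq> {}\<close> by (auto simp: invariant_set_def P_def)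
  thus False using no_finite finP by blast
qed

section \<open>Reduction to orientation-preserving words\<close>

lemma circle_homeos_comp:
  assumes "f \<in> circle_homeos" "g \<in> circle_homeos" shows "f \<circ> g \<in> circle_homeos"
  using assms homeomorphism_compose unfolding circle_homeos_def by blast

lemma lift_comp:
  assumes "lift f F" "lift g G" shows "lift (f \<circ> g) (F \<circ> G)"
  using assms continuous_on_compose[of UNIV G F] continuous_on_subset[of UNIV F]
  by (auto simp: lift_def)

lemma circle_homeos_reversing_lift:
  assumes "f \<in> circle_homeos" "f \<notin> circle_homeos_pos"
  obtains F where "lift f F" "strict_antimono_on UNIV F"
  using circle_homeo_lift[OF assms(1)] lift_homeo(2)[OF assms(1)] circle_homeos_posI assms by metis

text \<open>The semigroup generated by \<F>; no inverses are adjoined, as minimal sets are invariant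
  in the forward direction only.\<close>

inductive_set words :: "(complex \<Rightarrow> complex) set \<Rightarrow> (complex \<Rightarrow> complex) set" for \<F> where
  base: "f \<in> \<F> \<Longrightarrow> f \<in> words \<F>"
| comp: "f \<in> words \<F> \<Longrightarrow> g \<in> words \<F> \<Longrightarrow> f \<circ> g \<in> words \<F>"

lemma words_circle_homeos:
  assumes "w \<in> words \<F>" "\<F> \<subseteq> circle_homeos" shows "w \<in> circle_homeos"
  using assms by induction (auto intro: circle_homeos_comp)

lemma words_invariant:
  assumes "w \<in> words \<F>" "invariant_set \<F> K" shows "w ` K \<subseteq> K"
  using assms(1)
proof induction
  case (comp f g)
  thus ?case unfolding image_comp[symmetric] by blast
qed (use assms(2) invariant_setD(3) in blast)

text \<open>If \<open>P\<close> is a finite invariant set of the orientation-preserving words and \<open>s \<in> \<F>\<close> reverses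
  orientation, then \<open>P \<union> s ` P\<close> is \<open>\<F>\<close>-invariant.\<close>

lemma no_finite_invariant_words:
  assumes homeos: "\<F> \<subseteq> circle_homeos"
    and no_finite: "\<And>K. finite K \<Longrightarrow> \<not> invariant_set \<F> K"
    and P: "finite P" "invariant_set (words \<F> \<inter> circle_homeos_pos) P"
  shows False
proof (cases "\<F> \<subseteq> circle_homeos_pos")
  case True
  hence "\<F> \<subseteq> words \<F> \<inter> circle_homeos_pos" by (auto intro: words.base)
  hence "invariant_set \<F> P" using P(2) unfolding invariant_set_def by blast
  thus False using no_finite P(1) by blast
next
  case False
  then obtain s where s: "s \<in> \<F>" "s \<notin> circle_homeos_pos" by blast
  then obtain S where S: "lift s S" "strict_antimono_on UNIV S"
    using circle_homeos_reversing_lift homeos by blast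
  have Pc: "P \<subseteq> circle" using P(2) invariant_setD(2) by blast
  have anti: "F x < F y" if "strict_antimono_on UNIV F" "y < x" for F :: "real \<Rightarrow> real" and x y
    using monotone_onD[OF that(1), of y x] that(2) by simp
  \<comment> \<open>An injective map of a finite set into itself is onto; the resulting equality
    permits the cancellations below.\<close>
  have word: "w ` P = P" if w: "w \<in> words \<F>" "lift w W" "strict_mono W" for w W
  proof (rule endo_inj_surj)
    have "w \<in> circle_homeos" using words_circle_homeos homeos w(1) by blast
    thus "inj_on w P" using circle_homeosD(5) Pc inj_on_subset by blast
    show "w ` P \<subseteq> P"
      using P(2) w circle_homeos_posI[OF \<open>w \<in> circle_homeos\<close>] invariant_setD(3) by blast
  qed (rule P(1))
  have ss: "s ` s ` P = P"
    using word[OF words.comp lift_comp, of s s S S] s(1) S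
    by (auto simp: image_comp words.base strict_mono_def anti)
  have cancel: "A = B" if "s ` A = s ` B" "A \<subseteq> circle" "B \<subseteq> circle" for A B
    using that inj_on_image_eq_iff circle_homeosD(5) homeos s(1) by (metis subsetD)
  have img: "f ` A \<subseteq> circle" if "f \<in> \<F>" "A \<subseteq> circle" for f A
    using circle_homeosD(4) homeos that by blast
  have "f ` (P \<union> s ` P) \<subseteq> P \<union> s ` P" if f: "f \<in> \<F>" for f
  proof (cases "f \<in> circle_homeos_pos")
    case True
    then obtain F where F: "lift f F" "strict_mono F" using circle_homeos_pos_lift by blast
    \<comment> \<open>With \<open>s\<close> reversing and \<open>f\<close> preserving,
      \<open>s \<circ> f \<circ> s\<close> preserves orientation. Comparing it with
      \<open>s \<circ> s\<close> and cancelling the outer \<open>s\<close> shows that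
      \<open>f\<close> fixes the image of \<open>P\<close> under \<open>s\<close>.\<close>
    have "s ` f ` s ` P = P"
      using word[OF words.comp[OF _ words.comp] lift_comp[OF _ lift_comp], of s f s S F S] s(1) f S F
      by (auto simp: image_comp comp_assoc words.base strict_mono_def anti)
    hence "f ` s ` P = s ` P" using cancel[of "f ` s ` P" "s ` P"] img f s(1) Pc ss by simp
    moreover have "f ` P = P" using word[OF words.base[OF f] F] .
    ultimately show ?thesis by blast
  next
    case False
    then obtain F where F: "lift f F" "strict_antimono_on UNIV F"
      using circle_homeos_reversing_lift homeos f by blast
    \<comment> \<open>Both products of \<open>f\<close> and \<open>s\<close> preserve orientation.
      Comparing \<open>s \<circ> f\<close> with \<open>s \<circ> s\<close> shows that
      \<open>f\<close> and \<open>s\<close> have the same image of \<open>P\<close>, so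
      \<open>f\<close> exchanges the two sets.\<close>
    have "f ` s ` P = P" "s ` f ` P = P"
      using word[OF words.comp lift_comp, of f s F S] word[OF words.comp lift_comp, of s f S F] s(1) f S F
      by (auto simp: image_comp words.base strict_mono_def anti)
    moreover from this have "f ` P = s ` P" using cancel[of "f ` P" "s ` P"] img f s(1) Pc ss by simp
    ultimately show ?thesis by blast
  qed
  moreover have "P \<noteq> {}" using P(2) by (rule invariant_setD(1))
  ultimately have "invariant_set \<F> (P \<union> s ` P)"
    unfolding invariant_set_def using Pc img[OF s(1) Pc] by simp
  thus False using no_finite[of "P \<union> s ` P"] P(1) by simp
qed

text \<open>Each minimal set of \<F> contains one of the orientation-preserving words, and different
  minimal sets of \<F> are disjoint, so this choice is injective.\<close>

lemma finite_minimal_sets: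
  assumes homeos: "\<F> \<subseteq> circle_homeos"
    and no_finite: "\<And>K. finite K \<Longrightarrow> \<not> invariant_set \<F> K"
  shows "finite {K. minimal_set \<F> K}"
proof -
  define \<W> where "\<W> = words \<F> \<inter> circle_homeos_pos"
  have "finite {K. minimal_set \<W> K}"
    using no_finite_invariant_words[OF assms] by (intro finite_minimal_sets_pos) (auto simp: \<W>_def)
  moreover have "\<exists>L\<subseteq>K. minimal_set \<W> L" if K: "minimal_set \<F> K" for K
  proof -
    have "invariant_set \<W> K"
      using minimal_setD[OF K] words_invariant unfolding invariant_set_def \<W>_def by blast
    thus ?thesis using minimal_set_exists minimal_setD(1)[OF K] by metis
  qed
  then obtain m where m: "\<And>K. minimal_set \<F> K \<Longrightarrow> m K \<subseteq> K \<and> minimal_set \<W> (m K)" by metis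
  have "inj_on m {K. minimal_set \<F> K}"
  proof (rule inj_onI)
    fix K L assume KL: "K \<in> {K. minimal_set \<F> K}" "L \<in> {K. minimal_set \<F> K}" "m K = m L"
    have "m K \<subseteq> K" "m L \<subseteq> L" "m K \<noteq> {}" using m minimal_setD(3) KL(1,2) by auto
    then obtain z where "z \<in> K" "z \<in> L" using KL(3) by blast
    thus "K = L" using minimal_set_disjoint[of \<F> K L z] KL(1,2) by simp
  qed
  moreover have "m ` {K. minimal_set \<F> K} \<subseteq> {K. minimal_set \<W> K}" using m by auto
  ultimately show ?thesis using inj_on_finite by blast
qed

section \<open>The inverse family\<close>

lemma inverse_family_homeos:
  assumes "\<F> \<subseteq> circle_homeos" shows "inverse_family \<F> \<subseteq> circle_homeos"
  using assms circle_homeosD(1) homeomorphism_symD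
  unfolding inverse_family_def circle_homeos_def by blast

text \<open>A decreasing lift of the inverse, composed with the increasing lift of \<open>f\<close>,
  would be a decreasing lift of the identity, but lifts of the identity are translations.\<close>

lemma inverse_family_pos:
  assumes "\<F> \<subseteq> circle_homeos_pos" shows "inverse_family \<F> \<subseteq> circle_homeos_pos"
proof
  fix g assume "g \<in> inverse_family \<F>"
  then obtain f where f: "f \<in> circle_homeos_pos" "g = inv_into circle f"
    using assms by (auto simp: inverse_family_def)
  obtain F where F: "f \<in> circle_homeos" "lift f F" "strict_mono F"
    using circle_homeos_pos_lift[OF f(1)] by blast
  have g: "g \<in> circle_homeos"
    using inverse_family_homeos[of "{f}"] F(1) f(2) by (auto simp: inverse_family_def)
  show "g \<in> circle_homeos_pos"
  proof (rule ccontr)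
    assume "g \<notin> circle_homeos_pos"
    then obtain G where G: "lift g G" "strict_antimono_on UNIV G"
      using circle_homeos_reversing_lift g by blast
    have "lift (g \<circ> f) (G \<circ> F)" using lift_comp G(1) F(2) by blast
    moreover have "(g \<circ> f) (cis t) = cis t" for t
      using circle_homeosD(5)[OF F(1)] f(2) by (simp add: inv_into_f_f)
    ultimately have "continuous_on UNIV (G \<circ> F)" "\<And>t. cis (G (F t)) = cis t"
      by (auto simp: lift_def)
    hence "continuous_on UNIV (\<lambda>t. G (F t) - t)" "\<And>t. cis (G (F t) - t) = 1"
      by (auto simp: o_def intro: continuous_on_diff simp flip: cis_divide)
    then obtain n :: int where n: "\<And>t. G (F t) - t = 2 * pi * n" using cis_eq_1_const by blast
    have "G (F 1) < G (F 0)"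
      using monotone_onD[OF G(2), of "F 0" "F 1"] strict_monoD[OF F(3), of 0 1] by simp
    thus False using n[of 0] n[of 1] by simp
  qed
qed

text \<open>Inverting twice returns \<open>f\<close> on the circle only, since maps are total on the
  plane. The families may differ, but invariance looks only at values on the circle.\<close>

lemma invariant_set_inverse_inverse:
  assumes "\<F> \<subseteq> circle_homeos"
  shows "invariant_set (inverse_family (inverse_family \<F>)) K \<longleftrightarrow> invariant_set \<F> K"
proof -
  have "inv_into circle (inv_into circle f) ` K = f ` K" if "f \<in> \<F>" "K \<subseteq> circle" for f
  proof (rule image_cong)
    fix z assume "z \<in> K"
    thus "inv_into circle (inv_into circle f) z = f z"
      using inv_into_inv_into_eq[OF circle_homeosD(2)] that assms by blast
  qed simp
  hence "(\<forall>f\<in>\<F>. inv_into circle (inv_into circle f) ` K \<subseteq> K) \<longleftrightarrow> (\<forall>f\<in>\<F>. f ` K \<subseteq> K)"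
    if "K \<subseteq> circle" using that by (intro ball_cong refl) metis
  thus ?thesis unfolding invariant_set_def inverse_family_def ball_simps by blast
qed

lemma minimal_set_inverse_inverse:
  assumes "\<F> \<subseteq> circle_homeos"
  shows "minimal_set (inverse_family (inverse_family \<F>)) = minimal_set \<F>"
  using invariant_set_inverse_inverse[OF assms] by (auto simp: minimal_set_def)

text \<open>The inverse of \<open>f\<close> maps the finite set injectively into itself, hence onto
  itself, and so does \<open>f\<close>.\<close>

lemma finite_invariant_set_inverse:
  assumes "\<F> \<subseteq> circle_homeos" "finite K" "invariant_set (inverse_family \<F>) K"
  shows "invariant_set \<F> K"
proof -
  have "f ` K \<subseteq> K" if f: "f \<in> \<F>" for f
  proof -
    have K: "K \<subseteq> circle" "inv_into circle f ` K \<subseteq> K"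
      using assms(3) f by (auto simp: invariant_set_def inverse_family_def)
    have surj: "f ` circle = circle" using circle_homeosD(4) assms(1) f by blast
    hence "inj_on (inv_into circle f) K" using K(1) by (intro inj_on_inv_into) simp
    hence "inv_into circle f ` K = K" by (rule endo_inj_surj[OF assms(2) K(2)])
    hence "f ` K = f ` inv_into circle f ` K" by simp
    also have "\<dots> = K" using image_inv_into_cancel[OF surj K(1)] .
    finally show ?thesis by simp
  qed
  thus ?thesis using assms(3) by (auto simp: invariant_set_def)
qed

text \<open>Finiteness is part of the claim because \<open>card\<close> is 0 on infinite
  sets.\<close>

theorem corollary1:
  fixes \<F> :: "(complex \<Rightarrow> complex) set"
  assumes "\<F> \<subseteq> circle_homeos"
    and "\<not> (\<exists>K. finite K \<and> K \<noteq> {} \<and> invariant_set \<F> K)"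
  shows "finite {K. minimal_set \<F> K} \<and>
         finite {K. minimal_set (inverse_family \<F>) K} \<and>
         \<bar>int (card {K. minimal_set \<F> K}) - int (card {K. minimal_set (inverse_family \<F>) K})\<bar> \<le> 1 \<and>
         (\<F> \<subseteq> circle_homeos_pos \<longrightarrow>
            card {K. minimal_set \<F> K} = card {K. minimal_set (inverse_family \<F>) K})"
proof -
  let ?I = "inverse_family \<F>"
  have no: "\<And>K. finite K \<Longrightarrow> \<not> invariant_set \<F> K"
    using assms(2) invariant_setD(1) by blast
  have no': "\<And>K. finite K \<Longrightarrow> \<not> invariant_set ?I K"
    using no finite_invariant_set_inverse[OF assms(1)] by blast
  have no'': "\<And>K. finite K \<Longrightarrow> \<not> invariant_set (inverse_family ?I) K"
    using no invariant_set_inverse_inverse[OF assms(1)] by blast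
  note hom' = inverse_family_homeos[OF assms(1)]
  note eq = minimal_set_inverse_inverse[OF assms(1)]
  have fin: "finite {K. minimal_set \<F> K}" by (rule finite_minimal_sets[OF assms(1) no])
  have fin': "finite {K. minimal_set ?I K}" by (rule finite_minimal_sets[OF hom' no'])
  have fin'': "finite {K. minimal_set (inverse_family ?I) K}" using fin by (simp add: eq)
  have "card {K. minimal_set \<F> K} \<le> card {K. minimal_set ?I K} + 1"
    by (rule card_minimal_le[OF assms(1) no' fin order_refl fin'])
  moreover have "card {K. minimal_set ?I K} \<le> card {K. minimal_set \<F> K} + 1"
    using card_minimal_le[OF hom' no'' fin' order_refl fin''] by (simp add: eq)
  moreover have "card {K. minimal_set \<F> K} = card {K. minimal_set ?I K}" if pos: "\<F> \<subseteq> circle_homeos_pos"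
  proof (rule antisym)
    show "card {K. minimal_set \<F> K} \<le> card {K. minimal_set ?I K}"
      by (rule card_minimal_le_pos[OF assms(1) no' fin order_refl fin' pos])
    show "card {K. minimal_set ?I K} \<le> card {K. minimal_set \<F> K}"
      using card_minimal_le_pos[OF hom' no'' fin' order_refl fin'' inverse_family_pos[OF pos]]
      by (simp add: eq)
  qed
  ultimately show ?thesis using fin fin' by auto
qed

end
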